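(* Let $\hat p_h=(p_{\mathcal K},p_{\mathcal F})\in C^1(0,T;V_{h,0}^k)$ be the solution of the semi-discrete HHO scheme: for all $\hat q_h=(q_{\mathcal K},q_{\mathcal F})\in V_{h,0}^k$ and $t\in(0,T)$, $$(p_{\mathcal K t}(t),q_{\mathcal K})+b(\hat p_h(t),\hat q_h)+\int_0^t b(\hat p_h(s),\hat q_h)\,ds=(f(t),q_{\mathcal K}),\qquad \hat p_h(0)=\hat I_h^k(g).$$ Then, for $t\in(0,T)$, $$\|p_{\mathcal K}(t)\|^2+\int_0^t\|\hat p_h(s)\|_{1,h}^2\,ds+\Big\|\int_0^t\hat p_h(s)\,ds\Big\|_{1,h}^2\le \|g\|^2+C\int_0^t\|f(s)\|^2\,ds,$$ where $C=C_{dp}^2/C_{eqv}^2$.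
   Context: Setting. $\Omega\subset\mathbb R^2$ is a bounded convex polygonal domain, $T>0$, $k\ge0$ is an integer, $g\in H^1(\Omega)$ is the initial datum and $f(t)\in L^2(\Omega)$ the forcing term. $(\cdot,\cdot)$ and $\|\cdot\|$ are the $L^2(\Omega)$ inner product and norm; $(\cdot,\cdot)_K$ and $\langle\cdot,\cdot\rangle_F$ are the $L^2$ inner products on a cell $K$ and on a face $F$. A subscript $t$ denotes the time derivative. Mesh. $\mathcal K_h$ is a partition of $\Omega$ into finitely many closed connected polygonal cells $K$ of diameter $h_K$, $h=\max_K h_K$. $\mathcal F_h=\mathcal F_h^o\cup\mathcal F_h^\partial$ is the set of faces (edges), split into interfaces and boundary faces; $\mathcal F_K$ is the set of faces contained in $\partial K$, $h_F$ is the length of $F$, and $\mathbf n_{KF}$ is the unit normal on $F$ outward to $K$. The mesh belongs to a regular family in the usual HHO sense: there is $\rho\in(0,1)$ independent of $h$ such that the mesh admits a matching simplicial submesh in which every simplex has inradius at least $\rho$ times its diameter, and every simplex contained in a cell $K$ has diameter at least $\rho h_K$. Hybrid spaces. $V_h^k=\prod_{K\in\mathcal K_h}\mathcal P_k(K)\times\prod_{F\in\mathcal F_h}\mathcal P_k(F)$, where $\mathcal P_k$ denotes polynomials of degree at most $k$; elements are $\hat q_h=(q_{\mathcal K},q_{\mathcal F})$ with $q_{\mathcal K}=(q_K)_K$ (identified with the broken polynomial equal to $q_K$ on $K$) and $q_{\mathcal F}=(q_F)_F$. $V_{h,0}^k$ is the subspace with $q_F=0$ for all $F\in\mathcal F_h^\partial$.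 The restriction to $K$ is $\hat q_K=(q_K,(q_F)_{F\in\mathcal F_K})\in V_K^k=\mathcal P_k(K)\times\prod_{F\in\mathcal F_K}\mathcal P_k(F)$. With $\pi_K^k,\pi_F^k$ the $L^2$-orthogonal projections onto $\mathcal P_k(K),\mathcal P_k(F)$, $\hat I_h^k(v)=((\pi_K^k v)_K,(\pi_F^k v)_F)$ for $v\in H^1(\Omega)$. Reconstruction, stabilization, bilinear form. $R_K^{k+1}\hat q_K\in\mathcal P_{k+1}(K)$ is the unique solution of $(\nabla R_K^{k+1}\hat q_K,\nabla w)_K=(\nabla q_K,\nabla w)_K+\sum_{F\in\mathcal F_K}\langle q_F-q_K|_F,\mathbf n_{KF}\cdot\nabla w\rangle_F$ for all $w\in\mathcal P_{k+1}(K)$, with $(R_K^{k+1}\hat q_K,1)_K=(q_K,1)_K$. Let $\delta_K\hat q_K=\pi_K^k(R_K^{k+1}\hat q_K-q_K)$, $\delta_{KF}\hat q_K=\pi_F^k(R_K^{k+1}\hat q_K-q_F)$, and $s_K(\hat q_K,\hat r_K)=\sum_{F\in\mathcal F_K}h_F^{-1}\langle(\delta_{KF}-\delta_K)\hat q_K,(\delta_{KF}-\delta_K)\hat r_K\rangle_F$. Then $s_h=\sum_K s_K$ and $b(\hat q_h,\hat r_h)=\sum_K(\nabla R_K^{k+1}\hat q_K,\nabla R_K^{k+1}\hat r_K)_K+s_h(\hat q_h,\hat r_h)$, and $\|\hat q_h\|_{1,h}^2=b(\hat q_h,\hat q_h)$, which is a norm on $V_{h,0}^k$. Constants. Let $\|\hat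 q_h\|_{\mathrm{HHO}}^2=\sum_K\big(\|\nabla q_K\|_{L^2(K)}^2+\sum_{F\in\mathcal F_K}h_F^{-1}\|q_F-q_K|_F\|_{L^2(F)}^2\big)$. $C_{eqv}>0$ is a constant independent of $h$ with $C_{eqv}\|\hat q_h\|_{\mathrm{HHO}}\le\|\hat q_h\|_{1,h}\le C_{eqv}^{-1}\|\hat q_h\|_{\mathrm{HHO}}$ for all $\hat q_h\in V_{h,0}^k$, and $C_{dp}>0$ is a constant independent of $h$ with $\|q_{\mathcal K}\|\le C_{dp}\|\hat q_h\|_{\mathrm{HHO}}$ for all $\hat q_h\in V_{h,0}^k$ (discrete Poincaré inequality). *)

theory Defs
  imports "HOL-Analysis.Analysis"
begin

section \<open>Lebesgue and Sobolev spaces\<close>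

type_synonym plane = "real ^ 2"

definition l2_inner :: "'a measure \<Rightarrow> ('a \<Rightarrow> real) \<Rightarrow> ('a \<Rightarrow> real) \<Rightarrow> real" where
  "l2_inner M u v = (LINT x|M. u x * v x)"

definition l2_norm :: "'a measure \<Rightarrow> ('a \<Rightarrow> real) \<Rightarrow> real" where
  "l2_norm M u = sqrt (l2_inner M u u)"

definition L2 :: "'a measure \<Rightarrow> ('a \<Rightarrow> real) set" where
  "L2 M = {u \<in> borel_measurable M. integrable M (\<lambda>x. (u x)\<^sup>2)}"

definition grad :: "(plane \<Rightarrow> real) \<Rightarrow> plane \<Rightarrow> plane" where
  "grad u x = (THE D. GDERIV u x :> D)"

definition partial :: "2 \<Rightarrow> (plane \<Rightarrow> real) \<Rightarrow> plane \<Rightarrow> real" where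
  "partial i u x = grad u x $ i"

text \<open>A function is of class $C^\infty$ when all its iterated partial derivatives are
  (totally) differentiable everywhere; in particular they are then all continuous.\<close>

definition smooth :: "(plane \<Rightarrow> real) \<Rightarrow> bool" where
  "smooth u \<longleftrightarrow> (\<forall>is x. foldr partial is u differentiable (at x))"

definition test_function :: "plane set \<Rightarrow> (plane \<Rightarrow> real) \<Rightarrow> bool" where
  "test_function \<Omega> \<phi> \<longleftrightarrow> smooth \<phi> \<and> (\<exists>S. compact S \<and> S \<subseteq> \<Omega> \<and> (\<forall>x. x \<notin> S \<longrightarrow> \<phi> x = 0))"

definition weak_grad :: "plane set \<Rightarrow> (plane \<Rightarrow> real) \<Rightarrow> (plane \<Rightarrow> plane) \<Rightarrow> bool" where
  "weak_grad \<Omega> v G \<longleftrightarrow>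
     (\<forall>i. (\<lambda>x. G x $ i) \<in> L2 (lebesgue_on \<Omega>)) \<and>
     (\<forall>\<phi> i. test_function \<Omega> \<phi> \<longrightarrow>
        l2_inner (lebesgue_on \<Omega>) v (partial i \<phi>) = - l2_inner (lebesgue_on \<Omega>) (\<lambda>x. G x $ i) \<phi>)"

definition H1 :: "plane set \<Rightarrow> (plane \<Rightarrow> real) set" where
  "H1 \<Omega> = {v \<in> L2 (lebesgue_on \<Omega>). \<exists>G. weak_grad \<Omega> v G}"

text \<open>Arc-length measure on a segment; it does not depend on the order of the end points.\<close>

definition face_measure :: "plane set \<Rightarrow> plane measure" where
  "face_measure F =
     (let (a, b) = (SOME (a, b). F = closed_segment a b)
      in distr (restrict_space lborel {0..dist a b}) borel (\<lambda>s. a + (s / dist a b) *\<^sub>R (b - a)))"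

text \<open>The trace of an $H^1$ function on a segment contained in the closed domain, obtained by
  density of the smooth functions in $H^1(\Omega)$. It is determined up to equality
  almost everywhere for the arc-length measure, which is all its projection below uses.\<close>

definition is_trace :: "plane set \<Rightarrow> (plane \<Rightarrow> real) \<Rightarrow> plane set \<Rightarrow> (plane \<Rightarrow> real) \<Rightarrow> bool" where
  "is_trace \<Omega> v F \<gamma> \<longleftrightarrow>
     \<gamma> \<in> L2 (face_measure F) \<and>
     (\<exists>G \<phi>. weak_grad \<Omega> v G \<and> (\<forall>n. smooth (\<phi> n)) \<and>
        (\<lambda>n::nat. l2_norm (lebesgue_on \<Omega>) (\<lambda>x. \<phi> n x - v x)) \<longlonglongrightarrow> 0 \<and>
        (\<forall>i. (\<lambda>n. l2_norm (lebesgue_on \<Omega>) (\<lambda>x. partial i (\<phi> n) x - G x $ i)) \<longlonglongrightarrow> 0) \<and>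
        (\<lambda>n. l2_norm (face_measure F) (\<lambda>x. \<phi> n x - \<gamma> x)) \<longlonglongrightarrow> 0)"

definition trace_on :: "plane set \<Rightarrow> (plane \<Rightarrow> real) \<Rightarrow> plane set \<Rightarrow> plane \<Rightarrow> real" where
  "trace_on \<Omega> v F = (SOME \<gamma>. is_trace \<Omega> v F \<gamma>)"


section \<open>Domain and meshes\<close>

definition convex_polygonal_domain :: "plane set \<Rightarrow> bool" where
  "convex_polygonal_domain \<Omega> \<longleftrightarrow>
     open \<Omega> \<and> \<Omega> \<noteq> {} \<and> bounded \<Omega> \<and> convex \<Omega> \<and> polytope (closure \<Omega>)"

text \<open>A polygonal cell need not be convex; it may have holes.\<close>

definition polygonal :: "plane set \<Rightarrow> bool" where
  "polygonal K \<longleftrightarrow>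
     (\<exists>\<P>. finite \<P> \<and> \<P> \<noteq> {} \<and> (\<forall>P\<in>\<P>. polytope P \<and> interior P \<noteq> {}) \<and> K = \<Union>\<P>)"

datatype mesh = Mesh (cells: "plane set set") (faces: "plane set set")

text \<open>Finitely many points of the face are exempted because another vertex of the same cell may
  touch the face there. A face being infinite, the outward normal is unique if it exists.\<close>

definition outward_normal :: "plane set \<Rightarrow> plane set \<Rightarrow> plane \<Rightarrow> bool" where
  "outward_normal K F n \<longleftrightarrow>
     norm n = 1 \<and> (\<forall>x\<in>F. \<forall>y\<in>F. n \<bullet> (y - x) = 0) \<and>
     finite {x \<in> F. \<not> (\<exists>\<epsilon>>0. \<forall>s\<in>{0<..<\<epsilon>}. x - s *\<^sub>R n \<in> interior K \<and> x + s *\<^sub>R n \<notin> K)}"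

definition normal :: "plane set \<Rightarrow> plane set \<Rightarrow> plane" where
  "normal K F = (THE n. outward_normal K F n)"

definition cell_faces :: "mesh \<Rightarrow> plane set \<Rightarrow> plane set set" where
  "cell_faces m K = {F \<in> faces m. F \<subseteq> frontier K}"

definition boundary_faces :: "plane set \<Rightarrow> mesh \<Rightarrow> plane set set" where
  "boundary_faces \<Omega> m = {F \<in> faces m. F \<subseteq> frontier \<Omega>}"

text \<open>The faces decompose the skeleton. An edge of a cell may be split into several
  faces, so that hanging nodes are allowed.\<close>

definition polygonal_mesh :: "plane set \<Rightarrow> mesh \<Rightarrow> bool" where
  "polygonal_mesh \<Omega> m \<longleftrightarrow>
     finite (cells m) \<and>
     (\<forall>K\<in>cells m. closed K \<and> connected K \<and> polygonal K) \<and>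
     \<Union>(cells m) = closure \<Omega> \<and>
     (\<forall>K\<in>cells m. \<forall>K'\<in>cells m. K \<noteq> K' \<longrightarrow> interior K \<inter> interior K' = {}) \<and>
     finite (faces m) \<and>
     (\<forall>F\<in>faces m. \<exists>a b. a \<noteq> b \<and> F = closed_segment a b) \<and>
     (\<forall>F\<in>faces m. \<forall>F'\<in>faces m. F \<noteq> F' \<longrightarrow> rel_interior F \<inter> rel_interior F' = {}) \<and>
     \<Union>(faces m) = (\<Union>K\<in>cells m. frontier K) \<and>
     (\<forall>F\<in>faces m.
        (\<exists>K\<in>cells m. \<exists>K'\<in>cells m. K \<noteq> K' \<and> F \<subseteq> frontier K \<inter> frontier K') \<or>
        (\<exists>K\<in>cells m. F \<subseteq> frontier K \<inter> frontier \<Omega>)) \<and>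
     (\<forall>K\<in>cells m. \<forall>F\<in>cell_faces m K. \<exists>n. outward_normal K F n)"

definition inradius :: "plane set \<Rightarrow> real" where
  "inradius S = Sup {r. 0 \<le> r \<and> (\<exists>x. cball x r \<subseteq> S)}"

definition matching_simplicial_submesh :: "mesh \<Rightarrow> plane set set \<Rightarrow> bool" where
  "matching_simplicial_submesh m \<S> \<longleftrightarrow>
     triangulation \<S> \<and> (\<forall>S\<in>\<S>. 2 simplex S) \<and>
     (\<forall>S\<in>\<S>. \<exists>K\<in>cells m. S \<subseteq> K) \<and>
     (\<forall>K\<in>cells m. K = \<Union>{S \<in> \<S>. S \<subseteq> K}) \<and>
     (\<forall>S\<in>\<S>. \<forall>E. E facet_of S \<longrightarrow>
        (\<forall>F\<in>faces m. E \<subseteq> F \<or> rel_interior E \<inter> rel_interior F = {}))"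

definition regular_mesh :: "real \<Rightarrow> mesh \<Rightarrow> bool" where
  "regular_mesh \<rho> m \<longleftrightarrow>
     (\<exists>\<S>. matching_simplicial_submesh m \<S> \<and>
        (\<forall>S\<in>\<S>. inradius S \<ge> \<rho> * diameter S) \<and>
        (\<forall>K\<in>cells m. \<forall>S\<in>\<S>. S \<subseteq> K \<longrightarrow> diameter S \<ge> \<rho> * diameter K))"


section \<open>Hybrid spaces\<close>

definition polys :: "nat \<Rightarrow> (plane \<Rightarrow> real) set" where
  "polys k = {q. \<exists>c::nat \<Rightarrow> nat \<Rightarrow> real. q = (\<lambda>x. \<Sum>i\<le>k. \<Sum>j\<le>k - i. c i j * x $ 1 ^ i * x $ 2 ^ j)}"

text \<open>A polynomial on a cell is identified with its unique polynomial extension to the plane.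
  A polynomial on a face is the restriction of a polynomial in the plane, extended by zero
  outside the face; both encodings are unique and stable under linear combinations.\<close>

definition face_polys :: "nat \<Rightarrow> plane set \<Rightarrow> (plane \<Rightarrow> real) set" where
  "face_polys k F = {(\<lambda>x. indicat_real F x * q x) |q. q \<in> polys k}"

datatype hybrid =
  Hybrid (cellp: "plane set \<Rightarrow> plane \<Rightarrow> real") (facep: "plane set \<Rightarrow> plane \<Rightarrow> real")

definition Vh :: "mesh \<Rightarrow> nat \<Rightarrow> hybrid set" where
  "Vh m k = {q.
     (\<forall>K\<in>cells m. cellp q K \<in> polys k) \<and> (\<forall>K. K \<notin> cells m \<longrightarrow> cellp q K = (\<lambda>x. 0)) \<and>
     (\<forall>F\<in>faces m. facep q F \<in> face_polys k F) \<and> (\<forall>F. F \<notin> faces m \<longrightarrow> facep q F = (\<lambda>x. 0))}"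

definition Vh0 :: "plane set \<Rightarrow> mesh \<Rightarrow> nat \<Rightarrow> hybrid set" where
  "Vh0 \<Omega> m k = {q \<in> Vh m k. \<forall>F\<in>boundary_faces \<Omega> m. facep q F = (\<lambda>x. 0)}"

text \<open>The broken polynomial; its values on the skeleton, a null set, are irrelevant.\<close>

definition broken :: "mesh \<Rightarrow> (plane set \<Rightarrow> plane \<Rightarrow> real) \<Rightarrow> plane \<Rightarrow> real" where
  "broken m v x = (\<Sum>K\<in>cells m. indicat_real (interior K) x * v K x)"

definition l2_proj :: "plane measure \<Rightarrow> (plane \<Rightarrow> real) set \<Rightarrow> (plane \<Rightarrow> real) \<Rightarrow> plane \<Rightarrow> real" where
  "l2_proj M W u = (THE v. v \<in> W \<and> (\<forall>w\<in>W. l2_inner M v w = l2_inner M u w))"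

definition proj_cell :: "nat \<Rightarrow> plane set \<Rightarrow> (plane \<Rightarrow> real) \<Rightarrow> plane \<Rightarrow> real" where
  "proj_cell k K = l2_proj (lebesgue_on K) (polys k)"

definition proj_face :: "nat \<Rightarrow> plane set \<Rightarrow> (plane \<Rightarrow> real) \<Rightarrow> plane \<Rightarrow> real" where
  "proj_face k F = l2_proj (face_measure F) (face_polys k F)"

definition hho_interp :: "plane set \<Rightarrow> mesh \<Rightarrow> nat \<Rightarrow> (plane \<Rightarrow> real) \<Rightarrow> hybrid" where
  "hho_interp \<Omega> m k v = Hybrid
     (\<lambda>K. if K \<in> cells m then proj_cell k K v else (\<lambda>x. 0))
     (\<lambda>F. if F \<in> faces m then proj_face k F (trace_on \<Omega> v F) else (\<lambda>x. 0))"


section \<open>Reconstruction, stabilization and bilinear form\<close>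

definition grad_inner :: "plane set \<Rightarrow> (plane \<Rightarrow> real) \<Rightarrow> (plane \<Rightarrow> real) \<Rightarrow> real" where
  "grad_inner K u v = (LINT x|lebesgue_on K. grad u x \<bullet> grad v x)"

definition recon :: "mesh \<Rightarrow> nat \<Rightarrow> plane set \<Rightarrow> hybrid \<Rightarrow> plane \<Rightarrow> real" where
  "recon m k K q = (THE r. r \<in> polys (k + 1) \<and>
     (\<forall>w\<in>polys (k + 1).
        grad_inner K r w = grad_inner K (cellp q K) w +
          (\<Sum>F\<in>cell_faces m K. l2_inner (face_measure F)
             (\<lambda>x. facep q F x - cellp q K x) (\<lambda>x. normal K F \<bullet> grad w x))) \<and>
     l2_inner (lebesgue_on K) r (\<lambda>x. 1) = l2_inner (lebesgue_on K) (cellp q K) (\<lambda>x. 1))"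

definition delta_cell :: "mesh \<Rightarrow> nat \<Rightarrow> plane set \<Rightarrow> hybrid \<Rightarrow> plane \<Rightarrow> real" where
  "delta_cell m k K q = proj_cell k K (\<lambda>x. recon m k K q x - cellp q K x)"

definition delta_face :: "mesh \<Rightarrow> nat \<Rightarrow> plane set \<Rightarrow> plane set \<Rightarrow> hybrid \<Rightarrow> plane \<Rightarrow> real" where
  "delta_face m k K F q = proj_face k F (\<lambda>x. recon m k K q x - facep q F x)"

definition stab_cell :: "mesh \<Rightarrow> nat \<Rightarrow> plane set \<Rightarrow> hybrid \<Rightarrow> hybrid \<Rightarrow> real" where
  "stab_cell m k K q r =
     (\<Sum>F\<in>cell_faces m K. inverse (diameter F) *
        l2_inner (face_measure F)
          (\<lambda>x. delta_face m k K F q x - delta_cell m k K q x)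
          (\<lambda>x. delta_face m k K F r x - delta_cell m k K r x))"

definition bh :: "mesh \<Rightarrow> nat \<Rightarrow> hybrid \<Rightarrow> hybrid \<Rightarrow> real" where
  "bh m k q r =
     (\<Sum>K\<in>cells m. grad_inner K (recon m k K q) (recon m k K r)) +
     (\<Sum>K\<in>cells m. stab_cell m k K q r)"

definition norm_1h :: "mesh \<Rightarrow> nat \<Rightarrow> hybrid \<Rightarrow> real" where
  "norm_1h m k q = sqrt (bh m k q q)"

definition norm_HHO :: "mesh \<Rightarrow> hybrid \<Rightarrow> real" where
  "norm_HHO m q = sqrt (\<Sum>K\<in>cells m.
     grad_inner K (cellp q K) (cellp q K) +
     (\<Sum>F\<in>cell_faces m K. inverse (diameter F) *
        (l2_norm (face_measure F) (\<lambda>x. facep q F x - cellp q K x))\<^sup>2))"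


section \<open>Time-dependent hybrid functions\<close>

text \<open>The spaces are finite-dimensional spaces of functions, on which every vector space topology
  that is Hausdorff is that of pointwise convergence. Regularity in time, the time derivative and
  the time integral are therefore those of all point evaluations.\<close>

definition hybrid_C1 :: "mesh \<Rightarrow> real set \<Rightarrow> (real \<Rightarrow> hybrid) \<Rightarrow> bool" where
  "hybrid_C1 m I p \<longleftrightarrow>
     (\<forall>K\<in>cells m. \<forall>x. (\<lambda>t. cellp (p t) K x) C1_differentiable_on I) \<and>
     (\<forall>F\<in>faces m. \<forall>x. (\<lambda>t. facep (p t) F x) C1_differentiable_on I)"

definition cell_dt :: "(real \<Rightarrow> hybrid) \<Rightarrow> real \<Rightarrow> plane set \<Rightarrow> plane \<Rightarrow> real" where
  "cell_dt p t K x = deriv (\<lambda>s. cellp (p s) K x) t"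

definition hybrid_integrable :: "mesh \<Rightarrow> real set \<Rightarrow> (real \<Rightarrow> hybrid) \<Rightarrow> bool" where
  "hybrid_integrable m I p \<longleftrightarrow>
     (\<forall>K\<in>cells m. \<forall>x. set_integrable lborel I (\<lambda>t. cellp (p t) K x)) \<and>
     (\<forall>F\<in>faces m. \<forall>x. set_integrable lborel I (\<lambda>t. facep (p t) F x))"

definition hybrid_integral :: "real set \<Rightarrow> (real \<Rightarrow> hybrid) \<Rightarrow> hybrid" where
  "hybrid_integral I p = Hybrid
     (\<lambda>K x. LINT s:I|lborel. cellp (p s) K x)
     (\<lambda>F x. LINT s:I|lborel. facep (p s) F x)"

text \<open>Weak form of the initial condition: only the cell component, the one whose
  time derivative enters the scheme, is required to be continuous at the initial time. For
  general data the face component of a solution has a limit there that differs from the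
  face component of the interpolate.\<close>

definition initial_value :: "mesh \<Rightarrow> (real \<Rightarrow> hybrid) \<Rightarrow> hybrid \<Rightarrow> bool" where
  "initial_value m p q \<longleftrightarrow>
     p 0 = q \<and> (\<forall>K\<in>cells m. \<forall>x. ((\<lambda>t. cellp (p t) K x) \<longlongrightarrow> cellp q K x) (at_right 0))"

end

theory Submission
  imports Defs
begin

text \<open>Testing the scheme with \<open>p(t)\<close> and noting that \<open>b(\<integral>\<^sub>0\<^sup>t p, p(t))\<close> is half the derivative of
  \<open>\<parallel>\<integral>\<^sub>0\<^sup>t p\<parallel>\<^sup>2\<close> in the norm of \<open>b\<close>, the energy \<open>E(t) = \<parallel>p(t)\<parallel>\<^sup>2 + \<parallel>\<integral>\<^sub>0\<^sup>t p\<parallel>\<^sup>2\<close> satisfies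
  \<open>E' + 2 b(p, p) = 2 (f, p)\<close>. Young's inequality and the Poincare inequality bound the right-hand
  side by \<open>C \<parallel>f\<parallel>\<^sup>2 + b(p, p)\<close>. One integrates over \<open>[\<epsilon>, t]\<close> and lets \<open>\<epsilon>\<close> tend to 0, where the
  energy tends to the squared norm of the projection of \<open>g\<close>. What takes work is that \<open>b\<close> is bilinear,
  since reconstruction and projections are defined by unique solvability, and that integrals in time
  commute with it; for the latter, hybrid functions are expanded in coordinates that are point
  evaluations.\<close>

section \<open>Finite-dimensional spaces of functions\<close>

text \<open>The constant is the square of \<open>Cdp / Ceqv\<close>, the factor that bounds the L2
  norm of the cell part by the norm of \<open>bh\<close>. Young's inequality with exactly this
  weight turns the term in p into one copy of b(p, p); testing the scheme provides two, and the
  other one is the dissipation in the estimate. The obstacle is the initial time: the face part need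
  not be continuous there and b(p, p) is not known to be bounded near 0, so identities in time are
  proved for positive times only. The energy still has a limit, because its first term depends on
  the cell part, which converges, and the memory integral tends to 0. The forcing term carries no
  regularity in time; continuity of (f, p) is read off from the scheme. The argument in time is
  isolated in \<open>energy_estimate\<close>, a statement on finitely many scalar functions and a
  symmetric matrix, without meshes or polynomials.\<close>

definition fsubspace :: "('a \<Rightarrow> real) set \<Rightarrow> bool" where
  "fsubspace W \<longleftrightarrow> (\<lambda>x. 0) \<in> W \<and> (\<forall>u\<in>W. \<forall>v\<in>W. \<forall>a b. (\<lambda>x. a * u x + b * v x) \<in> W)"

definition flinear :: "('a \<Rightarrow> real) set \<Rightarrow> (('a \<Rightarrow> real) \<Rightarrow> real) \<Rightarrow> bool" where
  "flinear W L \<longleftrightarrow> (\<forall>u\<in>W. \<forall>v\<in>W. \<forall>a b. L (\<lambda>x. a * u x + b * v x) = a * L u + b * L v)"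

text \<open>The generators may be dependent. This matters on faces, where monomials in two variables
  satisfy linear relations along a line; the arguments below run by induction on the index set and
  never use independence.\<close>

definition spanned :: "'i set \<Rightarrow> ('i \<Rightarrow> 'a \<Rightarrow> real) \<Rightarrow> ('a \<Rightarrow> real) set" where
  "spanned J b = range (\<lambda>c x. \<Sum>j\<in>J. c j * b j x)"

lemma flinearD:
  "flinear W L \<Longrightarrow> u \<in> W \<Longrightarrow> v \<in> W \<Longrightarrow> L (\<lambda>x. a * u x + b * v x) = a * L u + b * L v"
  by (auto simp: flinear_def)

lemma fsubspace_comb: "fsubspace W \<Longrightarrow> u \<in> W \<Longrightarrow> v \<in> W \<Longrightarrow> (\<lambda>x. a * u x + b * v x) \<in> W"
  by (auto simp: fsubspace_def)

lemma fsubspace_zero: "fsubspace W \<Longrightarrow> (\<lambda>x. 0) \<in> W"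
  by (auto simp: fsubspace_def)

lemma fsubspace_scale: "fsubspace W \<Longrightarrow> u \<in> W \<Longrightarrow> (\<lambda>x. a * u x) \<in> W"
  using fsubspace_comb[of W u u a 0] by simp

lemma fsubspace_diff: "fsubspace W \<Longrightarrow> u \<in> W \<Longrightarrow> v \<in> W \<Longrightarrow> (\<lambda>x. u x - v x) \<in> W"
  using fsubspace_comb[of W u v 1 "-1"] by simp

lemma fsubspace_sum:
  assumes "fsubspace W" "\<And>i. i \<in> I \<Longrightarrow> w i \<in> W"
  shows "(\<lambda>x. \<Sum>i\<in>I. c i * w i x) \<in> W"
  using assms(2)
proof (induction I rule: infinite_finite_induct)
  case (insert i I)
  then have "(\<lambda>x. c i * w i x + 1 * (\<Sum>i\<in>I. c i * w i x)) \<in> W"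
    by (intro fsubspace_comb[OF assms(1)]) auto
  with insert show ?case by simp
qed (simp_all add: fsubspace_zero[OF assms(1)])

lemma flinear_zero:
  assumes "fsubspace W" "flinear W L" shows "L (\<lambda>x. 0) = 0"
  using flinearD[OF assms(2) fsubspace_zero[OF assms(1)] fsubspace_zero[OF assms(1)], of 0 0] by simp

lemma flinear_scale: "flinear W L \<Longrightarrow> u \<in> W \<Longrightarrow> L (\<lambda>x. a * u x) = a * L u"
  using flinearD[of W L u u a 0] by simp

lemma flinear_diff: "flinear W L \<Longrightarrow> u \<in> W \<Longrightarrow> v \<in> W \<Longrightarrow> L (\<lambda>x. u x - v x) = L u - L v"
  using flinearD[of W L u v 1 "-1"] by simp

lemma flinear_sum:
  assumes "fsubspace W" "flinear W L" "\<And>i. i \<in> I \<Longrightarrow> w i \<in> W"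
  shows "L (\<lambda>x. \<Sum>i\<in>I. c i * w i x) = (\<Sum>i\<in>I. c i * L (w i))"
  using assms(3)
proof (induction I rule: infinite_finite_induct)
  case (insert i I)
  have "L (\<lambda>x. c i * w i x + 1 * (\<Sum>i\<in>I. c i * w i x)) = c i * L (w i) + 1 * L (\<lambda>x. \<Sum>i\<in>I. c i * w i x)"
    using insert by (intro flinearD[OF assms(2)] fsubspace_sum[OF assms(1)]) auto
  with insert show ?case by simp
qed (simp_all add: flinear_zero[OF assms(1,2)])

lemma flinear_subset: "flinear W L \<Longrightarrow> V \<subseteq> W \<Longrightarrow> flinear V L"
  unfolding flinear_def by blast

lemma fsubspace_spanned: "fsubspace (spanned J b)"
  unfolding fsubspace_def
proof (intro conjI ballI allI)
  show "(\<lambda>x. 0) \<in> spanned J b"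
    unfolding spanned_def by (rule image_eqI[of _ _ "\<lambda>j. 0"]) auto
next
  fix u v s t assume "u \<in> spanned J b" "v \<in> spanned J b"
  then obtain c d where "u = (\<lambda>x. \<Sum>j\<in>J. c j * b j x)" "v = (\<lambda>x. \<Sum>j\<in>J. d j * b j x)"
    by (auto simp: spanned_def)
  then show "(\<lambda>x. s * u x + t * v x) \<in> spanned J b"
    unfolding spanned_def
    by (intro image_eqI[of _ _ "\<lambda>j. s * c j + t * d j"])
      (auto simp: sum_distrib_left sum.distrib algebra_simps)
qed

lemma spanned_empty: "spanned {} b = {\<lambda>x. 0}"
  by (auto simp: spanned_def)

lemma spanned_insert:
  assumes "finite J" "j \<notin> J"
  shows "w \<in> spanned (insert j J) b \<longleftrightarrow> (\<exists>c. \<exists>v\<in>spanned J b. w = (\<lambda>x. v x + c * b j x))"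
proof
  assume "w \<in> spanned (insert j J) b"
  then obtain c where "w = (\<lambda>x. \<Sum>j\<in>insert j J. c j * b j x)" by (auto simp: spanned_def)
  then have "w = (\<lambda>x. (\<Sum>j\<in>J. c j * b j x) + c j * b j x)" using assms by (simp add: add.commute)
  moreover have "(\<lambda>x. \<Sum>j\<in>J. c j * b j x) \<in> spanned J b"
    unfolding spanned_def by blast
  ultimately show "\<exists>c. \<exists>v\<in>spanned J b. w = (\<lambda>x. v x + c * b j x)"
    by (intro exI[of _ "c j"] bexI[of _ "\<lambda>x. \<Sum>j\<in>J. c j * b j x"])
next
  assume "\<exists>c. \<exists>v\<in>spanned J b. w = (\<lambda>x. v x + c * b j x)"
  then obtain c d where w: "w = (\<lambda>x. (\<Sum>j\<in>J. d j * b j x) + c * b j x)"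
    by (auto simp: spanned_def)
  have "(\<Sum>i\<in>insert j J. (d(j := c)) i * b i x) = (\<Sum>j\<in>J. d j * b j x) + c * b j x" for x
  proof -
    have "(\<Sum>i\<in>J. (d(j := c)) i * b i x) = (\<Sum>i\<in>J. d i * b i x)"
      using assms by (intro sum.cong) auto
    then show ?thesis using assms by simp
  qed
  then show "w \<in> spanned (insert j J) b"
    unfolding w spanned_def by (intro image_eqI[of _ _ "d(j := c)"]) auto
qed

lemma spanned_base: assumes "finite J" "j \<in> J" shows "b j \<in> spanned J b"
proof -
  have "(\<Sum>i\<in>J. (if i = j then 1 else 0) * b i x) = b j x" for x
    using assms by (simp add: if_distrib[of "\<lambda>t. t * _"] cong: if_cong)
  then show ?thesis
    unfolding spanned_def by (intro image_eqI[of _ _ "\<lambda>i. if i = j then 1 else 0"]) auto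
qed

text \<open>Coordinates that are point evaluations turn the pointwise notions of regularity in time
  into statements about finitely many scalar functions.\<close>

lemma nodal_basis:
  fixes b :: "'i \<Rightarrow> 'a \<Rightarrow> real"
  assumes "finite J"
  shows "\<exists>n x e. (\<forall>i<(n::nat). e i \<in> spanned J b) \<and>
    (\<forall>w\<in>spanned J b. \<forall>z. w z = (\<Sum>i<n. w (x i) * e i z))"
  using assms
proof (induction J rule: finite_induct)
  case empty
  then show ?case by (intro exI[of _ 0]) (auto simp: spanned_empty)
next
  case (insert j J)
  then obtain n x e where e: "\<And>i. i < (n::nat) \<Longrightarrow> e i \<in> spanned J b"
    and exp: "\<And>w z. w \<in> spanned J b \<Longrightarrow> w z = (\<Sum>i<n. w (x i) * e i z)"
    by blast
  let ?W = "spanned (insert j J) b"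
  have sub: "v \<in> ?W" if "v \<in> spanned J b" for v
    using that spanned_insert[OF insert(1,2), of v b] by (auto intro!: exI[of _ 0] bexI[of _ v])
  \<comment> \<open>The error in reproducing the new generator from the old nodes. If it vanishes
    everywhere, the old nodes suffice; otherwise a point where it does not vanish becomes the new
    node.\<close>
  define r where "r z = b j z - (\<Sum>i<n. b j (x i) * e i z)" for z
  have rW: "r \<in> ?W"
  proof -
    have "(\<lambda>z. b j z - (\<Sum>i<n. b j (x i) * e i z)) \<in> ?W"
      by (intro fsubspace_diff fsubspace_sum fsubspace_spanned spanned_base sub e) (use insert in auto)
    then show ?thesis unfolding r_def .
  qed
  \<comment> \<open>The expansion is linear in the function, so it need only be checked on the old
    span and on the new generator.\<close>
  have lin: "(\<Sum>i<N. (v (y i) + c * u (y i)) * d i z)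
      = (\<Sum>i<N. v (y i) * d i z) + c * (\<Sum>i<N. u (y i) * d i z)"
    for N :: nat and y :: "nat \<Rightarrow> 'a" and d :: "nat \<Rightarrow> 'a \<Rightarrow> real" and u v c z
    by (simp add: distrib_right sum.distrib sum_distrib_left mult.assoc)
  show ?case
  proof (cases "\<exists>y. r y \<noteq> 0")
    case False
    have "w z = (\<Sum>i<n. w (x i) * e i z)" if "w \<in> ?W" for w z
    proof -
      from that obtain c v where v: "v \<in> spanned J b" and w: "w = (\<lambda>x. v x + c * b j x)"
        using spanned_insert[OF insert(1,2)] by blast
      have "r z = 0" using False by blast
      then have "b j z = (\<Sum>i<n. b j (x i) * e i z)" unfolding r_def by linarith
      with exp[OF v, of z] show ?thesis
        unfolding w lin by metis
    qed
    then show ?thesis using e sub by blast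
  next
    case True
    then obtain y where y: "r y \<noteq> 0" by blast
    \<comment> \<open>Newton's update: \<open>ey\<close> is the error scaled to be 1 at
      \<open>y\<close>, and the old functions are corrected to vanish at \<open>y\<close>. The new
      expansion is the old one plus the old error at \<open>y\<close> times
      \<open>ey\<close>.\<close>
    define ey where "ey z = inverse (r y) * r z" for z
    define e' where "e' i = (if i < n then (\<lambda>z. e i z - e i y * ey z) else ey)" for i
    define x' where "x' i = (if i < n then x i else y)" for i
    have eyW: "ey \<in> ?W" using fsubspace_scale[OF fsubspace_spanned rW] by (simp add: ey_def[abs_def])
    have eW': "e' i \<in> ?W" for i
    proof (cases "i < n")
      case True
      then show ?thesis
        unfolding e'_def using fsubspace_diff[OF fsubspace_spanned sub[OF e] fsubspace_scale[OF fsubspace_spanned eyW]]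
        by simp
    qed (simp add: e'_def eyW)
    have "w z = (\<Sum>i<Suc n. w (x' i) * e' i z)" if "w \<in> ?W" for w z
    proof -
      from that obtain c v where v: "v \<in> spanned J b" and w: "w = (\<lambda>x. v x + c * b j x)"
        using spanned_insert[OF insert(1,2)] by blast
      have expand: "(\<Sum>i<Suc n. u (x' i) * e' i z)
          = (\<Sum>i<n. u (x i) * e i z) + (u y - (\<Sum>i<n. u (x i) * e i y)) * ey z" for u
        by (simp add: x'_def e'_def algebra_simps sum_subtractf sum_distrib_left)
      have "v z = (\<Sum>i<Suc n. v (x' i) * e' i z)"
        unfolding expand using exp[OF v, of z] exp[OF v, of y] by simp
      moreover have "b j z = (\<Sum>i<Suc n. b j (x' i) * e' i z)"
        
      proof -
        have "r y * (inverse (r y) * r z) = r z" using y by simp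
        then show ?thesis unfolding expand r_def[symmetric] ey_def using r_def[of z] by linarith
      qed
      ultimately show ?thesis
        unfolding w lin by metis
    qed
    with eW' show ?thesis by blast
  qed
qed

section \<open>Riesz representation for definite forms on a finite span\<close>

locale definite_form =
  fixes J :: "'i set" and b :: "'i \<Rightarrow> 'a \<Rightarrow> real" and W :: "('a \<Rightarrow> real) set"
    and a :: "('a \<Rightarrow> real) \<Rightarrow> ('a \<Rightarrow> real) \<Rightarrow> real"
  assumes fin: "finite J" and W_eq: "W = spanned J b"
    and a_sym: "\<And>u v. a u v = a v u"
    and a_lin: "\<And>v. v \<in> W \<Longrightarrow> flinear W (\<lambda>u. a u v)"
    and a_def: "\<And>u. u \<in> W \<Longrightarrow> a u u = 0 \<Longrightarrow> u = (\<lambda>x. 0)"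
begin

lemma W_sub: "fsubspace W" by (simp add: W_eq fsubspace_spanned)

lemma a_lin': "v \<in> W \<Longrightarrow> flinear W (a v)"
  using a_lin[of v] by (subst (asm) a_sym)

text \<open>Gram-Schmidt over the generators: subtracting from \<open>b j\<close> its representer on
  the old span leaves \<open>r\<close>, orthogonal to that span, and the old representer is
  corrected by a multiple of \<open>r\<close>. The functional is quantified inside the induction
  because the hypothesis is applied both to \<open>L\<close> and to \<open>a (b j)\<close>.\<close>

lemma representation_aux:
  assumes "finite I" "I \<subseteq> J"
  shows "\<forall>L. flinear W L \<longrightarrow> (\<exists>v\<in>spanned I b. \<forall>w\<in>spanned I b. a v w = L w)"
  using assms
proof (induction I rule: finite_induct)
  case empty
  show ?case
    using flinear_zero[OF W_sub] flinear_zero[OF W_sub a_lin'[OF fsubspace_zero[OF W_sub]]]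
    by (auto simp: spanned_empty)
next
  case (insert j I)
  have sub: "spanned (insert j I) b \<subseteq> W"
  proof
    fix w assume "w \<in> spanned (insert j I) b"
    then obtain c where "w = (\<lambda>x. \<Sum>j\<in>insert j I. c j * b j x)" by (auto simp: spanned_def)
    moreover have "b i \<in> W" if "i \<in> insert j I" for i
      using that insert(4) spanned_base[OF fin, of _ b] W_eq by blast
    ultimately show "w \<in> W" using fsubspace_sum[OF W_sub, of "insert j I" b c] by simp
  qed
  have subI: "w \<in> spanned (insert j I) b" if "w \<in> spanned I b" for w
    using that spanned_insert[OF insert(1,2), of w b] by (auto intro!: exI[of _ 0] bexI[of _ w])
  have bj: "b j \<in> spanned (insert j I) b" using insert by (intro spanned_base) auto
  then have bjW: "b j \<in> W" using sub by blast
  then obtain pb where pb: "pb \<in> spanned I b" "\<And>w. w \<in> spanned I b \<Longrightarrow> a pb w = a (b j) w"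
    using insert a_lin' by blast
  define r where "r = (\<lambda>x. b j x - pb x)"
  have rI: "r \<in> spanned (insert j I) b"
    unfolding r_def by (intro fsubspace_diff[OF fsubspace_spanned] bj subI pb(1))
  then have rW: "r \<in> W" using sub by blast
  have orth: "a r w = 0" if "w \<in> spanned I b" for w
  proof -
    have "a r w = a (b j) w - a pb w"
      unfolding r_def using that subI sub pb(1) bjW
      by (intro flinear_diff[OF a_lin[of w]]) auto
    then show ?thesis using pb(2)[OF that] by simp
  qed
  show ?case
  proof (intro allI impI)
    fix L assume L: "flinear W L"
    then obtain v where v: "v \<in> spanned I b" "\<And>w. w \<in> spanned I b \<Longrightarrow> a v w = L w"
      using insert by blast
    \<comment> \<open>By definiteness \<open>a r r = 0\<close> only if \<open>r = 0\<close>, that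
      is, if the generator depends on the old ones. Then \<open>L r = 0\<close> as well, so the
      default 0 also satisfies \<open>s * a r r = L r\<close>.\<close>
    define s where "s = (if a r r = 0 then 0 else L r / a r r)"
    have sr: "s * a r r = L r"
    proof (cases "a r r = 0")
      case True
      then show ?thesis using a_def[OF rW] flinear_zero[OF W_sub L] by simp
    qed (simp add: s_def)
    let ?v = "\<lambda>x. 1 * v x + s * r x"
    have vW: "v \<in> W" using subI sub v(1) by blast
    have aw: "a ?v w = a v w + s * a r w" if "w \<in> W" for w
      using flinearD[OF a_lin[OF that] vW rW, of 1 s] by simp
    have "a ?v w = L w" if w: "w \<in> spanned (insert j I) b" for w
    proof -
      from w obtain c u where u: "u \<in> spanned I b" and w_eq: "w = (\<lambda>x. u x + c * b j x)"
        using spanned_insert[OF insert(1,2)] by blast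
      let ?u' = "\<lambda>x. 1 * u x + c * pb x"
      have u': "?u' \<in> spanned I b" by (intro fsubspace_comb[OF fsubspace_spanned] u pb(1))
      then have u'W: "?u' \<in> W" using subI sub by blast
      \<comment> \<open>Orthogonal splitting: \<open>?u'\<close> absorbs the projection
        \<open>c * pb\<close> of the new term, so the cross terms between the two parts
        vanish.\<close>
      have w2: "w = (\<lambda>x. 1 * ?u' x + c * r x)" by (auto simp: w_eq r_def algebra_simps)
      have vW': "?v \<in> W" by (intro fsubspace_comb[OF W_sub] vW rW)
      have "a ?v w = 1 * a ?v ?u' + c * a ?v r"
        unfolding w2 by (rule flinearD[OF a_lin'[OF vW'] u'W rW])
      also have "\<dots> = L ?u' + c * L r"
        using aw[OF u'W] aw[OF rW] orth[OF u'] v(2)[OF u'] orth[OF v(1)] a_sym[of v r] sr by simp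
      also have "\<dots> = L w"
        unfolding w2 using flinearD[OF L u'W rW, of 1 c] by simp
      finally show ?thesis .
    qed
    moreover have "?v \<in> spanned (insert j I) b"
      by (intro fsubspace_comb[OF fsubspace_spanned] subI v(1) rI)
    ultimately show "\<exists>v\<in>spanned (insert j I) b. \<forall>w\<in>spanned (insert j I) b. a v w = L w"
      by blast
  qed
qed

text \<open>The body repeats the description in \<open>l2_proj\<close>, so that both projections
  become instances by mere unfolding.\<close>

definition rep :: "(('a \<Rightarrow> real) \<Rightarrow> real) \<Rightarrow> 'a \<Rightarrow> real" where
  "rep L = (THE v. v \<in> W \<and> (\<forall>w\<in>W. a v w = L w))"

lemma rep_unique:
  assumes "v \<in> W" "v' \<in> W" "\<And>w. w \<in> W \<Longrightarrow> a v w = a v' w"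
  shows "v = v'"
proof -
  have d: "(\<lambda>x. v x - v' x) \<in> W" by (intro fsubspace_diff[OF W_sub] assms)
  have "a (\<lambda>x. v x - v' x) (\<lambda>x. v x - v' x) = 0"
    using flinear_diff[OF a_lin[OF d] assms(1,2)] assms(3)[OF d] by simp
  from a_def[OF d this] show ?thesis by (auto simp: fun_eq_iff)
qed

lemma rep:
  assumes "flinear W L"
  shows rep_in: "rep L \<in> W" and rep_eq: "w \<in> W \<Longrightarrow> a (rep L) w = L w"
proof -
  from representation_aux[OF fin subset_refl] assms
  obtain v where "v \<in> W" "\<forall>w\<in>W. a v w = L w" unfolding W_eq by blast
  then have "\<exists>!v. v \<in> W \<and> (\<forall>w\<in>W. a v w = L w)"
    using rep_unique by (intro ex1I[of _ v]) (blast, metis)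
  from theI'[OF this] have "rep L \<in> W \<and> (\<forall>w\<in>W. a (rep L) w = L w)"
    unfolding rep_def .
  then show "rep L \<in> W" "w \<in> W \<Longrightarrow> a (rep L) w = L w" by auto
qed

lemma rep_eqI:
  assumes "v \<in> W" "\<And>w. w \<in> W \<Longrightarrow> a v w = L w"
  shows "rep L = v"
  unfolding rep_def using assms rep_unique by (intro the_equality) (blast, metis)

text \<open>A combination of representers represents the combined functional, and uniqueness
  identifies it. Projections and reconstruction inherit their linearity from here, their functionals
  being linear in the data.\<close>

lemma rep_sum:
  assumes "\<And>i. i \<in> I \<Longrightarrow> flinear W (L i)" "\<And>w. w \<in> W \<Longrightarrow> M w = (\<Sum>i\<in>I. c i * L i w)"
  shows "rep M = (\<lambda>x. \<Sum>i\<in>I. c i * rep (L i) x)"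
proof (rule rep_eqI)
  show "(\<lambda>x. \<Sum>i\<in>I. c i * rep (L i) x) \<in> W"
    by (intro fsubspace_sum[OF W_sub] rep_in assms)
next
  fix w assume w: "w \<in> W"
  have "a (\<lambda>x. \<Sum>i\<in>I. c i * rep (L i) x) w = (\<Sum>i\<in>I. c i * a (rep (L i)) w)"
    by (intro flinear_sum[OF W_sub a_lin[OF w]] rep_in assms)
  also have "\<dots> = M w"
    unfolding assms(2)[OF w] using rep_eq[OF assms(1) w] by (intro sum.cong) auto
  finally show "a (\<lambda>x. \<Sum>i\<in>I. c i * rep (L i) x) w = M w" .
qed

end

section \<open>The space L2\<close>

lemma L2_prod_integrable:
  assumes "u \<in> L2 M" "v \<in> L2 M" shows "integrable M (\<lambda>x. u x * v x)"
proof (rule Bochner_Integration.integrable_bound)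
  show "integrable M (\<lambda>x. (u x)\<^sup>2 + (v x)\<^sup>2)" using assms by (auto simp: L2_def)
  show "(\<lambda>x. u x * v x) \<in> borel_measurable M" using assms by (auto simp: L2_def)
  have "\<bar>s * t\<bar> \<le> s\<^sup>2 + t\<^sup>2" for s t :: real
  proof -
    have "0 \<le> (\<bar>s\<bar> - \<bar>t\<bar>)\<^sup>2" by simp
    then have "2 * (\<bar>s\<bar> * \<bar>t\<bar>) \<le> s\<^sup>2 + t\<^sup>2" by (simp add: power2_diff)
    moreover have "0 \<le> \<bar>s\<bar> * \<bar>t\<bar>" by simp
    ultimately show ?thesis unfolding abs_mult by linarith
  qed
  then show "AE x in M. norm (u x * v x) \<le> norm ((u x)\<^sup>2 + (v x)\<^sup>2)" by simp
qed

lemma fsubspace_L2: "fsubspace (L2 M)"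
  unfolding fsubspace_def
proof (intro conjI ballI allI)
  fix u v a b assume uv: "u \<in> L2 M" "v \<in> L2 M"
  have "(\<lambda>x. (a * u x + b * v x)\<^sup>2) = (\<lambda>x. a\<^sup>2 * (u x)\<^sup>2 + (2 * a * b) * (u x * v x) + b\<^sup>2 * (v x)\<^sup>2)"
    by (auto simp: power2_eq_square algebra_simps)
  moreover have "integrable M (\<lambda>x. a\<^sup>2 * (u x)\<^sup>2 + (2 * a * b) * (u x * v x) + b\<^sup>2 * (v x)\<^sup>2)"
    using uv L2_prod_integrable[OF uv] by (intro Bochner_Integration.integrable_add integrable_mult_right) (auto simp: L2_def)
  ultimately show "(\<lambda>x. a * u x + b * v x) \<in> L2 M" using uv by (auto simp: L2_def)
qed (auto simp: L2_def)

lemma l2_inner_commute: "l2_inner M u v = l2_inner M v u"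
  by (simp add: l2_inner_def mult.commute)

lemma l2_inner_nonneg: "0 \<le> l2_inner M u u"
  by (simp add: l2_inner_def)

lemma l2_norm_sq: "(l2_norm M u)\<^sup>2 = l2_inner M u u"
  by (simp add: l2_norm_def l2_inner_nonneg)

lemma flinear_l2_inner:
  assumes "v \<in> L2 M" shows "flinear (L2 M) (\<lambda>u. l2_inner M u v)"
  unfolding flinear_def
proof (intro ballI allI)
  fix u w a b assume "u \<in> L2 M" "w \<in> L2 M"
  then have "integrable M (\<lambda>x. u x * v x)" "integrable M (\<lambda>x. w x * v x)"
    using assms L2_prod_integrable by blast+
  moreover have "(\<lambda>x. (a * u x + b * w x) * v x) = (\<lambda>x. a * (u x * v x) + b * (w x * v x))"
    by (auto simp: algebra_simps)
  ultimately show "l2_inner M (\<lambda>x. a * u x + b * w x) v = a * l2_inner M u v + b * l2_inner M w v"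
    by (simp add: l2_inner_def)
qed

lemma flinear_l2_inner':
  assumes "v \<in> L2 M" shows "flinear (L2 M) (l2_inner M v)"
  using flinear_l2_inner[OF assms] by (subst (asm) l2_inner_commute)

text \<open>Pointwise this is \<open>0 \<le> (c * s - t)\<^sup>2 / c\<close>. The weight stays free:
  1 gives the contraction property of the projection, \<open>Cdp\<^sup>2 / Ceqv\<^sup>2\<close> the
  stability constant.\<close>

lemma l2_inner_young:
  assumes "u \<in> L2 M" "v \<in> L2 M" "c > 0"
  shows "2 * l2_inner M u v \<le> c * (l2_norm M u)\<^sup>2 + (l2_norm M v)\<^sup>2 / c"
proof -
  have "2 * (s * t) \<le> c * s\<^sup>2 + t\<^sup>2 / c" for s t :: real
  proof -
    have "0 \<le> (c * s - t)\<^sup>2 / c" using assms(3) by simp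
    also have "\<dots> = c * s\<^sup>2 + t\<^sup>2 / c - 2 * (s * t)"
      using assms(3) by (simp add: power2_eq_square field_simps)
    finally show ?thesis by simp
  qed
  then have "(LINT x|M. 2 * (u x * v x)) \<le> (LINT x|M. c * (u x)\<^sup>2 + (v x)\<^sup>2 / c)"
    using assms L2_prod_integrable[OF assms(1,2)] by (intro integral_mono) (auto simp: L2_def)
  also have "\<dots> = c * (LINT x|M. (u x)\<^sup>2) + (LINT x|M. (v x)\<^sup>2) / c"
    using assms by (subst Bochner_Integration.integral_add) (auto simp: L2_def)
  finally show ?thesis
    unfolding l2_norm_sq l2_inner_def by (simp add: power2_eq_square)
qed

lemma l2_inner_self_eq_0:
  assumes "u \<in> L2 M" "l2_inner M u u = 0" shows "AE x in M. u x = 0"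
proof -
  have "(LINT x|M. (u x)\<^sup>2) = 0" using assms(2) by (simp add: l2_inner_def power2_eq_square)
  then have "AE x in M. (u x)\<^sup>2 = 0"
    using assms(1) by (subst (asm) integral_nonneg_eq_0_iff_AE) (auto simp: L2_def)
  then show ?thesis by simp
qed

section \<open>Polynomials\<close>

lemma polys_spanned:
  "polys k = spanned (SIGMA i:{..k}. {..k - i}) (\<lambda>(i, j) x. x $ 1 ^ i * x $ 2 ^ j)"
proof -
  have eq: "(\<Sum>p\<in>(SIGMA i:{..k}. {..k - i}). c p * (case p of (i, j) \<Rightarrow> \<lambda>x. x $ 1 ^ i * x $ 2 ^ j) x)
      = (\<Sum>i\<le>k. \<Sum>j\<le>k - i. c (i, j) * x $ 1 ^ i * x $ 2 ^ j)" for c and x :: plane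
    by (subst sum.Sigma) (auto simp: case_prod_beta mult.assoc)
  show ?thesis
  proof (intro equalityI subsetI)
    fix q assume "q \<in> polys k"
    then obtain c where "q = (\<lambda>x. \<Sum>i\<le>k. \<Sum>j\<le>k - i. c i j * x $ 1 ^ i * x $ 2 ^ j)"
      by (auto simp: polys_def)
    then show "q \<in> spanned (SIGMA i:{..k}. {..k - i}) (\<lambda>(i, j) x. x $ 1 ^ i * x $ 2 ^ j)"
      unfolding spanned_def by (intro image_eqI[of _ _ "\<lambda>(i, j). c i j"]) (auto simp: eq)
  next
    fix q :: "plane \<Rightarrow> real"
    assume "q \<in> spanned (SIGMA i:{..k}. {..k - i}) (\<lambda>(i, j) x. x $ 1 ^ i * x $ 2 ^ j)"
    then obtain c where "q = (\<lambda>x. \<Sum>i\<le>k. \<Sum>j\<le>k - i. c (i, j) * x $ 1 ^ i * x $ 2 ^ j)"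
      unfolding spanned_def eq by blast
    then show "q \<in> polys k" unfolding polys_def by (auto intro!: exI[of _ "\<lambda>i j. c (i, j)"])
  qed
qed

lemma finite_poly_index: "finite (SIGMA i:{..k::nat}. {..k - i})"
  by auto

lemma fsubspace_polys: "fsubspace (polys k)"
  by (simp add: polys_spanned fsubspace_spanned)

lemma const_in_polys: "(\<lambda>x. c) \<in> polys k"
proof -
  have "(case (0, 0) of (i, j) \<Rightarrow> \<lambda>x::plane. x $ 1 ^ i * x $ 2 ^ j) \<in> polys k"
    unfolding polys_spanned by (rule spanned_base[OF finite_poly_index]) auto
  from fsubspace_scale[OF fsubspace_polys this, of c] show ?thesis by simp
qed

section \<open>Continuously differentiable functions on the plane\<close>

definition c1_plane :: "(plane \<Rightarrow> real) set" where
  "c1_plane = {u. \<exists>D. (\<forall>x. GDERIV u x :> D x) \<and> continuous_on UNIV D}"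

lemma grad_eq: assumes "GDERIV u x :> D" shows "grad u x = D"
  unfolding grad_def
proof (rule the_equality)
  fix D' assume "GDERIV u x :> D'"
  then have "(\<lambda>h. h \<bullet> D') = (\<lambda>h. h \<bullet> D)"
    using assms unfolding gderiv_def by (rule has_derivative_unique)
  then have "\<forall>h. h \<bullet> D' = h \<bullet> D" by (rule fun_cong[THEN allI])
  then show "D' = D" by (simp only: vector_eq_ldot)
qed fact

lemma c1_grad:
  assumes "u \<in> c1_plane" shows "GDERIV u x :> grad u x" "continuous_on UNIV (grad u)"
proof -
  from assms obtain D where D: "\<And>x. GDERIV u x :> D x" "continuous_on UNIV D"
    by (auto simp: c1_plane_def)
  from grad_eq[OF D(1)] have "grad u = D" by auto
  with D show "GDERIV u x :> grad u x" "continuous_on UNIV (grad u)" by auto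
qed

lemma c1_continuous: assumes "u \<in> c1_plane" shows "continuous_on UNIV u"
proof -
  have "u differentiable (at x)" for x
    using c1_grad(1)[OF assms, of x] by (auto simp: gderiv_def differentiable_def)
  then show ?thesis by (intro differentiable_imp_continuous_on) (auto simp: differentiable_on_def)
qed

lemma c1_comb_grad:
  assumes "u \<in> c1_plane" "v \<in> c1_plane"
  shows "GDERIV (\<lambda>x. a * u x + b * v x) x :> a *\<^sub>R grad u x + b *\<^sub>R grad v x"
proof -
  have "GDERIV (\<lambda>x. a * u x + b * v x) x
      :> (a *\<^sub>R grad u x + u x *\<^sub>R 0) + (b *\<^sub>R grad v x + v x *\<^sub>R 0)"
    by (intro GDERIV_add GDERIV_mult GDERIV_const c1_grad assms)
  then show ?thesis by simp
qed

text \<open>Since \<open>grad\<close> is a definite description, it is linear only where gradients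
  exist; membership in \<open>c1_plane\<close> ensures this for polynomials of degree
  \<open>k\<close> and \<open>k + 1\<close> alike.\<close>

lemma grad_comb:
  assumes "u \<in> c1_plane" "v \<in> c1_plane"
  shows "grad (\<lambda>x. a * u x + b * v x) x = a *\<^sub>R grad u x + b *\<^sub>R grad v x"
  by (rule grad_eq[OF c1_comb_grad[OF assms]])

lemma grad_const: "grad (\<lambda>x. c) x = 0"
  by (rule grad_eq[OF GDERIV_const])

lemma c1_const: "(\<lambda>x. c) \<in> c1_plane"
  unfolding c1_plane_def by (auto intro!: exI[of _ "\<lambda>x. 0"] GDERIV_const)

lemma fsubspace_c1: "fsubspace c1_plane"
  unfolding fsubspace_def
proof (intro conjI ballI allI)
  fix u v a b assume uv: "u \<in> c1_plane" "v \<in> c1_plane"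
  show "(\<lambda>x. a * u x + b * v x) \<in> c1_plane"
    unfolding c1_plane_def
    using c1_comb_grad[OF uv] c1_grad(2)[OF uv(1)] c1_grad(2)[OF uv(2)]
    by (auto intro!: exI[of _ "\<lambda>x. a *\<^sub>R grad u x + b *\<^sub>R grad v x"] continuous_intros)
qed (rule c1_const)

lemma c1_mult:
  assumes "u \<in> c1_plane" "v \<in> c1_plane" shows "(\<lambda>x. u x * v x) \<in> c1_plane"
  unfolding c1_plane_def
  using GDERIV_mult[OF c1_grad(1)[OF assms(1)] c1_grad(1)[OF assms(2)]]
    c1_grad(2)[OF assms(1)] c1_grad(2)[OF assms(2)] c1_continuous[OF assms(1)] c1_continuous[OF assms(2)]
  by (auto intro!: exI[of _ "\<lambda>x. u x *\<^sub>R grad v x + v x *\<^sub>R grad u x"] continuous_intros)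

lemma c1_coordinate: "(\<lambda>x. x $ i) \<in> c1_plane"
proof -
  have "((\<lambda>x. x $ i) has_derivative (\<lambda>h. h $ i)) (at x)" for x :: plane
    by (intro bounded_linear_imp_has_derivative bounded_linear_vec_nth)
  then have "GDERIV (\<lambda>x. x $ i) x :> axis i 1" for x :: plane
    by (simp add: gderiv_def inner_axis)
  then show ?thesis unfolding c1_plane_def by (auto intro!: exI[of _ "\<lambda>x. axis i 1"])
qed

lemma c1_power: assumes "u \<in> c1_plane" shows "(\<lambda>x. u x ^ n) \<in> c1_plane"
proof (induction n)
  case (Suc n) then show ?case using c1_mult[OF assms Suc] by simp
qed (simp add: c1_const)

lemma polys_c1: "polys k \<subseteq> c1_plane"
proof
  fix q assume "q \<in> polys k"
  then obtain c where "q = (\<lambda>x. \<Sum>p\<in>(SIGMA i:{..k}. {..k - i}). c p * (case p of (i, j) \<Rightarrow> \<lambda>x. x $ 1 ^ i * x $ 2 ^ j) x)"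
    by (auto simp: polys_spanned spanned_def)
  then show "q \<in> c1_plane"
    by (auto intro!: fsubspace_sum[OF fsubspace_c1] c1_mult c1_power c1_coordinate)
qed

lemma polys_continuous: "q \<in> polys k \<Longrightarrow> continuous_on UNIV q"
  using polys_c1 c1_continuous by blast

text \<open>Restricted to a line, a bivariate polynomial is a univariate one; both identity theorems
  needed below, on a disc and on a segment, reduce to this.\<close>

lemma polys_line:
  assumes "q \<in> polys k" "infinite {t. q (a + t *\<^sub>R d) = 0}"
  shows "q (a + t *\<^sub>R d) = 0"
proof -
  from assms(1) obtain c where q: "q = (\<lambda>x. \<Sum>i\<le>k. \<Sum>j\<le>k - i. c i j * x $ 1 ^ i * x $ 2 ^ j)"
    by (auto simp: polys_def)
  define P where "P = (\<Sum>i\<le>k. \<Sum>j\<le>k - i. [:c i j:] * [:a $ 1, d $ 1:] ^ i * [:a $ 2, d $ 2:] ^ j)"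
  have P: "q (a + t *\<^sub>R d) = poly P t" for t
    by (simp add: q P_def poly_sum mult.assoc)
  then have "infinite {t. poly P t = 0}" using assms(2) by simp
  then have "P = 0" using poly_roots_finite by blast
  then show ?thesis by (simp add: P)
qed

text \<open>The line from a point of \<open>U\<close> to an arbitrary \<open>z\<close> meets
  \<open>U\<close> in an open, hence infinite, set of parameters; the polynomial then vanishes along
  the line, in particular at parameter 1, which is \<open>z\<close>.\<close>

lemma polys_zero_on_open:
  assumes "q \<in> polys k" "open U" "U \<noteq> {}" "\<And>x. x \<in> U \<Longrightarrow> q x = 0"
  shows "q = (\<lambda>x. 0)"
proof
  fix z
  obtain a where "a \<in> U" using assms(3) by blast
  let ?l = "\<lambda>t. a + t *\<^sub>R (z - a)"
  have "open (?l -` U)" by (intro open_vimage assms(2) continuous_intros)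
  moreover have "0 \<in> ?l -` U" using \<open>a \<in> U\<close> by simp
  ultimately have "infinite (?l -` U)" using finite_imp_not_open by blast
  moreover have "?l -` U \<subseteq> {t. q (?l t) = 0}" using assms(4) by auto
  ultimately have "infinite {t. q (?l t) = 0}" using finite_subset by blast
  from polys_line[OF assms(1) this, of 1] show "q z = 0" by simp
qed

section \<open>Cells\<close>

text \<open>What the analysis uses of a polygon: compactness makes continuous functions integrable,
  a nonempty interior feeds the identity theorem for polynomials, and a null boundary allows passing
  between a cell and its interior.\<close>

definition is_cell :: "plane set \<Rightarrow> bool" where
  "is_cell K \<longleftrightarrow> compact K \<and> interior K \<noteq> {} \<and> negligible (frontier K)"

text \<open>The frontier of a finite union lies in the union of the frontiers, and each piece is
  convex, hence has a null frontier.\<close>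

lemma polygonal_is_cell: assumes "polygonal K" shows "is_cell K"
proof -
  from assms obtain P where P: "finite P" "P \<noteq> {}" "\<And>p. p \<in> P \<Longrightarrow> polytope p \<and> interior p \<noteq> {}"
    "K = \<Union>P" by (auto simp: polygonal_def)
  have "compact K" unfolding P(4) using P by (intro compact_Union) (auto intro: polytope_imp_compact)
  moreover have "interior K \<noteq> {}"
  proof -
    obtain p where "p \<in> P" using P(2) by blast
    then have "interior p \<subseteq> interior K" unfolding P(4) by (intro interior_mono) auto
    with P(3)[OF \<open>p \<in> P\<close>] show ?thesis by auto
  qed
  moreover have "negligible (frontier (\<Union>P))"
    using P(1,3)
  proof (induction P rule: finite_induct)
    case (insert p P)
    then have "negligible (frontier p \<union> frontier (\<Union>P))"
      by (auto intro!: negligible_Un negligible_convex_frontier polytope_imp_convex)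
    from negligible_subset[OF this frontier_Un_subset] show ?case by simp
  qed auto
  ultimately show ?thesis by (simp add: is_cell_def P(4))
qed

lemma cell_sets: "is_cell K \<Longrightarrow> K \<in> sets lebesgue"
  by (auto simp: is_cell_def intro!: borel_closed compact_imp_closed sets_completionI_sets)

lemma cell_integrable:
  fixes u :: "plane \<Rightarrow> real"
  assumes "is_cell K" "continuous_on UNIV u"
  shows "integrable (lebesgue_on K) u"
proof -
  have "integrable lborel (\<lambda>x. indicator K x *\<^sub>R u x)"
    using assms by (intro borel_integrable_compact) (auto simp: is_cell_def intro: continuous_on_subset)
  then have "integrable lebesgue (\<lambda>x. indicator K x *\<^sub>R u x)"
    by (simp add: integrable_completion)
  then show ?thesis using cell_sets[OF assms(1)] by (simp add: integrable_restrict_space)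
qed

lemma cell_L2:
  assumes "is_cell K" "continuous_on UNIV u" shows "u \<in> L2 (lebesgue_on K)"
  using cell_integrable[OF assms] cell_integrable[OF assms(1), of "\<lambda>x. (u x)\<^sup>2"] assms(2)
  by (auto simp: L2_def intro!: continuous_intros)

lemma polys_L2_cell: "is_cell K \<Longrightarrow> polys k \<subseteq> L2 (lebesgue_on K)"
  using cell_L2 polys_continuous by blast

text \<open>The points of the interior where \<open>u\<close> does not vanish form an open null set,
  which must be empty.\<close>

lemma cell_AE_zero:
  fixes u :: "plane \<Rightarrow> real"
  assumes K: "is_cell K" and u: "continuous_on UNIV u" and ae: "AE x in lebesgue_on K. u x = 0"
    and x: "x \<in> interior K"
  shows "u x = 0"
proof (rule ccontr)
  assume ux: "u x \<noteq> 0"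
  let ?U = "interior K \<inter> u -` (- {0})"
  have "open ?U" by (intro open_Int open_interior open_vimage u) auto
  moreover have "negligible ?U"
  proof -
    have "AE x in lebesgue. x \<in> K \<longrightarrow> u x = 0"
      using ae cell_sets[OF K] by (simp add: AE_restrict_space_iff)
    then have "negligible {x. \<not> (x \<in> K \<longrightarrow> u x = 0)}"
      by (simp add: negligible_iff_null_sets completion.AE_iff_null_sets AE_iff_null_sets)
    then show ?thesis by (rule negligible_subset) (use interior_subset in auto)
  qed
  ultimately have "?U = {}" using open_not_negligible by blast
  with x ux show False by auto
qed

lemma proj_cell_form:
  assumes "is_cell K"
  shows "definite_form (SIGMA i:{..k}. {..k - i}) (\<lambda>(i, j) x. x $ 1 ^ i * x $ 2 ^ j) (polys k)
    (l2_inner (lebesgue_on K))"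
proof
  show "flinear (polys k) (\<lambda>u. l2_inner (lebesgue_on K) u v)" if "v \<in> polys k" for v
    using flinear_subset[OF flinear_l2_inner polys_L2_cell[OF assms]] that polys_L2_cell[OF assms, of k]
    by blast
  show "u = (\<lambda>x. 0)" if u: "u \<in> polys k" "l2_inner (lebesgue_on K) u u = 0" for u
  proof (rule polys_zero_on_open[OF u(1), of "interior K"])
    show "u x = 0" if "x \<in> interior K" for x
      by (rule cell_AE_zero[OF assms polys_continuous[OF u(1)] _ that])
        (use l2_inner_self_eq_0 u polys_L2_cell[OF assms] in blast)
  qed (use assms in \<open>auto simp: is_cell_def\<close>)
qed (auto simp: polys_spanned l2_inner_commute)

section \<open>The gradient form on a cell\<close>

lemma grad_inner_commute: "grad_inner K u v = grad_inner K v u"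
  by (simp add: grad_inner_def inner_commute)

lemma grad_inner_nonneg: "0 \<le> grad_inner K u u"
  by (simp add: grad_inner_def)

lemma grad_inner_integrable:
  assumes "is_cell K" "u \<in> c1_plane" "v \<in> c1_plane"
  shows "integrable (lebesgue_on K) (\<lambda>x. grad u x \<bullet> grad v x)"
  using c1_grad(2)[OF assms(2)] c1_grad(2)[OF assms(3)]
  by (intro cell_integrable assms continuous_intros)

lemma flinear_grad_inner:
  assumes "is_cell K" "v \<in> c1_plane"
  shows "flinear c1_plane (\<lambda>u. grad_inner K u v)"
  unfolding flinear_def
proof (intro ballI allI)
  fix u w a b assume "u \<in> c1_plane" "w \<in> c1_plane"
  then show "grad_inner K (\<lambda>x. a * u x + b * w x) v = a * grad_inner K u v + b * grad_inner K w v"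
    using grad_inner_integrable[OF assms(1) _ assms(2)]
    by (simp add: grad_inner_def grad_comb inner_add_left)
qed

lemma flinear_grad_inner':
  assumes "is_cell K" "v \<in> c1_plane"
  shows "flinear c1_plane (grad_inner K v)"
  using flinear_grad_inner[OF assms] by (subst (asm) grad_inner_commute)

text \<open>By continuity the gradient vanishes on the whole interior, but the interior of a cell
  may be disconnected. So \<open>u\<close> is shown to be constant on one ball, and the identity
  theorem carries this to the plane.\<close>

lemma polys_grad_zero:
  assumes K: "is_cell K" and u: "u \<in> polys k" and 0: "grad_inner K u u = 0"
  shows "\<exists>c. u = (\<lambda>x. c)"
proof -
  have uc: "u \<in> c1_plane" using u polys_c1 by blast
  have "AE x in lebesgue_on K. grad u x \<bullet> grad u x = 0"
    using 0 grad_inner_integrable[OF K uc uc]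
    unfolding grad_inner_def by (subst (asm) integral_nonneg_eq_0_iff_AE) auto
  then have g0: "grad u x = 0" if "x \<in> interior K" for x
    using cell_AE_zero[OF K _ _ that, of "\<lambda>x. grad u x \<bullet> grad u x"] c1_grad(2)[OF uc]
    by (auto intro!: continuous_intros)
  obtain a where "a \<in> interior K" using K by (auto simp: is_cell_def)
  then obtain r where r: "r > 0" "ball a r \<subseteq> interior K"
    using open_contains_ball[of "interior K"] by auto
  have "(u has_derivative (\<lambda>h. 0)) (at x within ball a r)" if "x \<in> ball a r" for x
  proof -
    have "grad u x = 0" using g0 that r(2) by blast
    then have "(u has_derivative (\<lambda>h. 0)) (at x)"
      using c1_grad(1)[OF uc, of x] by (simp add: gderiv_def)
    then show ?thesis by (rule has_derivative_at_withinI)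
  qed
  from has_derivative_zero_constant[OF convex_ball this] obtain c where c: "\<forall>x\<in>ball a r. u x = c"
    by blast
  have "(\<lambda>x. u x - c) = (\<lambda>x. 0)"
    using r(1) c
    by (intro polys_zero_on_open[where U = "ball a r" and k = k] fsubspace_diff[OF fsubspace_polys] u const_in_polys) auto
  then show ?thesis by (auto simp: fun_eq_iff intro!: exI[of _ c])
qed

lemma l2_inner_const_pos:
  assumes "is_cell K" shows "l2_inner (lebesgue_on K) (\<lambda>x. 1) (\<lambda>x. 1) > 0"
proof -
  interpret definite_form "SIGMA i:{..0::nat}. {..0 - i}" "\<lambda>(i, j) x. x $ 1 ^ i * x $ 2 ^ j" "polys 0"
    "l2_inner (lebesgue_on K)" by (rule proj_cell_form[OF assms])
  have "l2_inner (lebesgue_on K) (\<lambda>x. 1) (\<lambda>x. 1) \<noteq> 0"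
    using a_def[OF const_in_polys, of 1] by (auto simp: fun_eq_iff)
  then show ?thesis using l2_inner_nonneg[of "lebesgue_on K" "\<lambda>x. 1"] by linarith
qed

text \<open>Adding the product of the means makes the gradient form definite and turns the two
  conditions defining the reconstruction into a single one.\<close>

definition recon_form :: "plane set \<Rightarrow> (plane \<Rightarrow> real) \<Rightarrow> (plane \<Rightarrow> real) \<Rightarrow> real" where
  "recon_form K u w = grad_inner K u w
     + l2_inner (lebesgue_on K) u (\<lambda>x. 1) * l2_inner (lebesgue_on K) w (\<lambda>x. 1)"

text \<open>On the diagonal both summands are nonnegative. If they vanish, the gradient part leaves
  a constant and the mean part forces it to be 0, the cell having positive measure.\<close>

lemma recon_form:
  assumes K: "is_cell K"
  shows "definite_form (SIGMA i:{..k}. {..k - i}) (\<lambda>(i, j) x. x $ 1 ^ i * x $ 2 ^ j) (polys k) (recon_form K)"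
proof
  show "recon_form K u v = recon_form K v u" for u v
    by (simp add: recon_form_def grad_inner_commute mult.commute)
next
  fix v assume v: "v \<in> polys k"
  have 1: "flinear (polys k) (\<lambda>u. grad_inner K u v)"
    using flinear_subset[OF flinear_grad_inner[OF K] polys_c1] v polys_c1 by blast
  have 2: "flinear (polys k) (\<lambda>u. l2_inner (lebesgue_on K) u (\<lambda>x. 1))"
    by (rule flinear_subset[OF flinear_l2_inner polys_L2_cell[OF K]]) (auto intro!: cell_L2 K)
  show "flinear (polys k) (\<lambda>u. recon_form K u v)"
    unfolding flinear_def recon_form_def
    by (auto simp: flinearD[OF 1] flinearD[OF 2] algebra_simps)
next
  fix u assume u: "u \<in> polys k" and 0: "recon_form K u u = 0"
  then have "grad_inner K u u = 0" and m0: "l2_inner (lebesgue_on K) u (\<lambda>x. 1) = 0"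
    using grad_inner_nonneg[of K u] unfolding recon_form_def
    by (simp_all add: add_nonneg_eq_0_iff)
  from polys_grad_zero[OF K u this(1)] obtain c where c: "u = (\<lambda>x. c)" by blast
  have "l2_inner (lebesgue_on K) (\<lambda>x. c * 1) (\<lambda>x. 1) = c * l2_inner (lebesgue_on K) (\<lambda>x. 1) (\<lambda>x. 1)"
    by (rule flinear_scale[OF flinear_l2_inner]) (auto intro!: cell_L2 K)
  with m0 l2_inner_const_pos[OF K] show "u = (\<lambda>x. 0)" by (simp add: c)
qed (auto simp: polys_spanned)

section \<open>Faces\<close>

definition is_face :: "plane set \<Rightarrow> bool" where
  "is_face F \<longleftrightarrow> (\<exists>a b. a \<noteq> b \<and> F = closed_segment a b)"

text \<open>The end points in \<open>face_measure\<close> come from a choice operator. Exporting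
  only that some suitable pair exists avoids any comparison with the end points given by the
  mesh.\<close>

lemma face_measure_eq:
  assumes "is_face F"
  obtains a b where "a \<noteq> b" "F = closed_segment a b"
    "face_measure F = distr (restrict_space lborel {0..dist a b}) borel (\<lambda>s. a + (s / dist a b) *\<^sub>R (b - a))"
proof -
  obtain a b where ab: "(SOME (a, b). F = closed_segment a b) = (a, b)" by fastforce
  have "\<exists>p. case p of (a, b) \<Rightarrow> F = closed_segment a b" using assms by (auto simp: is_face_def)
  from someI_ex[OF this] have F: "F = closed_segment a b" by (simp add: ab)
  moreover have "a \<noteq> b"
  proof
    assume "a = b"
    then have "F = {a}" using F by simp
    moreover obtain c d where "c \<noteq> d" "F = closed_segment c d"
      using assms by (auto simp: is_face_def)
    ultimately show False by (metis ends_in_segment singletonD)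
  qed
  moreover have "face_measure F
      = distr (restrict_space lborel {0..dist a b}) borel (\<lambda>s. a + (s / dist a b) *\<^sub>R (b - a))"
    by (simp only: face_measure_def ab Let_def prod.case)
  ultimately show ?thesis using that by blast
qed

lemma face_param:
  assumes "a \<noteq> b" "s \<in> {0..dist a b}"
  shows "a + (s / dist a b) *\<^sub>R (b - a) \<in> closed_segment a b"
  using assms unfolding closed_segment_def
  by (auto intro!: exI[of _ "s / dist a b"] simp: algebra_simps)

lemma face_measurable:
  "(\<lambda>s. a + (s / dist a b) *\<^sub>R (b - a)) \<in> restrict_space lborel {0..dist a b} \<rightarrow>\<^sub>M (borel :: plane measure)"
  by (intro measurable_restrict_space1) measurable

text \<open>The measure is the image of a bounded interval under a parametrization with values in
  \<open>F\<close>, so a bound on \<open>F\<close> alone suffices for a function on the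
  plane.\<close>

lemma face_L2:
  assumes F: "is_face F" and u: "u \<in> borel_measurable borel" and b: "\<And>x. x \<in> F \<Longrightarrow> \<bar>u x\<bar> \<le> B"
  shows "u \<in> L2 (face_measure F)"
proof -
  obtain a b where ab: "a \<noteq> b" "F = closed_segment a b"
    "face_measure F = distr (restrict_space lborel {0..dist a b}) borel (\<lambda>s. a + (s / dist a b) *\<^sub>R (b - a))"
    using face_measure_eq[OF F] by blast
  interpret finite_measure "restrict_space lborel {0..dist a b}"
    by (rule finite_measureI) (simp add: emeasure_restrict_space space_restrict_space)
  let ?g = "\<lambda>s. a + (s / dist a b) *\<^sub>R (b - a)"
  have m: "(\<lambda>s. u (?g s)) \<in> borel_measurable (restrict_space lborel {0..dist a b})"
    using measurable_compose[OF face_measurable u] .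
  have "integrable (restrict_space lborel {0..dist a b}) (\<lambda>s. (u (?g s))\<^sup>2)"
  proof (rule integrable_const_bound)
    show "AE s in restrict_space lborel {0..dist a b}. norm ((u (?g s))\<^sup>2) \<le> B\<^sup>2"
    proof (rule AE_I2)
      fix s assume "s \<in> space (restrict_space lborel {0..dist a b})"
      then have "?g s \<in> F" using face_param[OF ab(1)] by (simp add: ab(2) space_restrict_space)
      from b[OF this] have "\<bar>u (?g s)\<bar>\<^sup>2 \<le> B\<^sup>2" by (intro power_mono) auto
      then show "norm ((u (?g s))\<^sup>2) \<le> B\<^sup>2" by simp
    qed
  qed (use m in measurable)
  then have "integrable (face_measure F) (\<lambda>x. (u x)\<^sup>2)"
    unfolding ab(3) using u by (subst integrable_distr_eq[OF face_measurable]) auto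
  then show ?thesis using u by (simp add: L2_def ab(3))
qed

lemma compact_face: "is_face F \<Longrightarrow> compact F"
  by (auto simp: is_face_def)

lemma face_L2_continuous:
  assumes F: "is_face F" and u: "continuous_on UNIV u"
  shows "u \<in> L2 (face_measure F)" "(\<lambda>x. indicat_real F x * u x) \<in> L2 (face_measure F)"
proof -
  have "compact (u ` F)"
    using compact_face[OF F] u by (intro compact_continuous_image) (auto intro: continuous_on_subset)
  then have "bounded (u ` F)" by (rule compact_imp_bounded)
  then obtain B where B: "\<And>x. x \<in> F \<Longrightarrow> \<bar>u x\<bar> \<le> B" by (auto simp: bounded_iff)
  have um: "u \<in> borel_measurable borel" using u by (rule borel_measurable_continuous_onI)
  then show "u \<in> L2 (face_measure F)" using B by (rule face_L2[OF F])
  have "F \<in> sets borel" using compact_face[OF F] by (intro borel_closed compact_imp_closed)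
  then have "(\<lambda>x. indicat_real F x * u x) \<in> borel_measurable borel" using um by measurable
  then show "(\<lambda>x. indicat_real F x * u x) \<in> L2 (face_measure F)"
    using B by (intro face_L2[OF F, of _ B]) auto
qed

lemma face_polys_spanned:
  "face_polys k F = spanned (SIGMA i:{..k}. {..k - i}) (\<lambda>(i, j) x. indicat_real F x * (x $ 1 ^ i * x $ 2 ^ j))"
proof -
  have *: "(\<lambda>x. indicat_real F x * (\<Sum>p\<in>I. c p * (case p of (i, j) \<Rightarrow> \<lambda>x. x $ 1 ^ i * x $ 2 ^ j) x))
      = (\<lambda>x. \<Sum>p\<in>I. c p * (case p of (i, j) \<Rightarrow> \<lambda>x. indicat_real F x * (x $ 1 ^ i * x $ 2 ^ j)) x)"
    for c :: "nat \<times> nat \<Rightarrow> real" and I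
    by (auto simp: sum_distrib_left case_prod_beta algebra_simps)
  have "face_polys k F = (\<lambda>q x. indicat_real F x * q x) ` polys k"
    by (auto simp: face_polys_def)
  then show ?thesis by (simp only: polys_spanned spanned_def image_image *)
qed

lemma fsubspace_face_polys: "fsubspace (face_polys k F)"
  by (simp add: face_polys_spanned fsubspace_spanned)

lemma face_polys_L2: "is_face F \<Longrightarrow> face_polys k F \<subseteq> L2 (face_measure F)"
  using face_L2_continuous(2) polys_continuous by (fastforce simp: face_polys_def)

lemma polys_L2_face: "is_face F \<Longrightarrow> polys k \<subseteq> L2 (face_measure F)"
  using face_L2_continuous(1) polys_continuous by blast

text \<open>Pulled back to arc length, \<open>u\<close> vanishes on an interval up to a null set. If
  \<open>q\<close> had finitely many zeros on the line, two null sets would cover the interval; so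
  it has infinitely many and vanishes on the line, and the indicator settles the points off the
  face.\<close>

lemma face_polys_AE_zero:
  assumes F: "is_face F" and u: "u \<in> face_polys k F" and ae: "AE x in face_measure F. u x = 0"
  shows "u = (\<lambda>x. 0)"
proof -
  obtain a b where ab: "a \<noteq> b" "F = closed_segment a b"
    "face_measure F = distr (restrict_space lborel {0..dist a b}) borel (\<lambda>s. a + (s / dist a b) *\<^sub>R (b - a))"
    using face_measure_eq[OF F] by blast
  let ?g = "\<lambda>s. a + (s / dist a b) *\<^sub>R (b - a)"
  obtain q where q: "q \<in> polys k" "u = (\<lambda>x. indicat_real F x * q x)"
    using u by (auto simp: face_polys_def)
  have um: "u \<in> borel_measurable borel"
    using face_polys_L2[OF F] u by (auto simp: L2_def ab(3))
  have "AE s in restrict_space lborel {0..dist a b}. u (?g s) = 0"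
    using ae um unfolding ab(3) by (subst (asm) AE_distr_iff[OF face_measurable]) auto
  then have "AE s in lborel. s \<in> {0..dist a b} \<longrightarrow> u (?g s) = 0"
    by (subst (asm) AE_restrict_space_iff) auto
  then obtain N where N: "N \<in> null_sets lborel" "{s. \<not> (s \<in> {0..dist a b} \<longrightarrow> u (?g s) = 0)} \<subseteq> N"
    by (auto simp: eventually_ae_filter)
  let ?Z = "{t. q (a + t *\<^sub>R (b - a)) = 0}"
  have "infinite ?Z"
  proof
    assume "finite ?Z"
    \<comment> \<open>Zeros are parametrized by multiples of \<open>b - a\<close>, the measure by
      arc length; the factor \<open>dist a b\<close> translates.\<close>
    then have fin: "finite ((\<lambda>t. t * dist a b) ` ?Z)" by simp
    have "{0..dist a b} \<subseteq> N \<union> (\<lambda>t. t * dist a b) ` ?Z"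
    proof
      fix s assume s: "s \<in> {0..dist a b}"
      show "s \<in> N \<union> (\<lambda>t. t * dist a b) ` ?Z"
      proof (cases "s \<in> N")
        case False
        then have "u (?g s) = 0" using N(2) s by auto
        then have "q (?g s) = 0" using face_param[OF ab(1) s] by (simp add: q(2) ab(2))
        then show ?thesis using ab(1) by (auto intro!: image_eqI[of _ _ "s / dist a b"])
      qed auto
    qed
    moreover have "N \<union> (\<lambda>t. t * dist a b) ` ?Z \<in> null_sets lborel"
      by (intro null_sets.Un N(1) finite_imp_null_set_lborel fin)
    ultimately have "{0..dist a b} \<in> null_sets lborel"
      by (rule null_sets_subset[rotated 2]) auto
    then have "emeasure lborel {0..dist a b} = 0" by auto
    then show False using ab(1) by simp
  qed
  from polys_line[OF q(1) this] have q0: "q (a + t *\<^sub>R (b - a)) = 0" for t .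
  have "q x = 0" if "x \<in> F" for x
  proof -
    from that obtain t where "x = (1 - t) *\<^sub>R a + t *\<^sub>R b" by (auto simp: ab(2) closed_segment_def)
    then have "x = a + t *\<^sub>R (b - a)" by (simp add: algebra_simps)
    then show ?thesis using q0 by simp
  qed
  then show ?thesis by (auto simp: q(2) indicator_def)
qed

lemma proj_face_form:
  assumes "is_face F"
  shows "definite_form (SIGMA i:{..k}. {..k - i})
    (\<lambda>(i, j) x. indicat_real F x * (x $ 1 ^ i * x $ 2 ^ j)) (face_polys k F)
    (l2_inner (face_measure F))"
proof
  show "flinear (face_polys k F) (\<lambda>u. l2_inner (face_measure F) u v)" if "v \<in> face_polys k F" for v
    using flinear_subset[OF flinear_l2_inner face_polys_L2[OF assms]] that face_polys_L2[OF assms, of k]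
    by blast
  show "u = (\<lambda>x. 0)" if u: "u \<in> face_polys k F" "l2_inner (face_measure F) u u = 0" for u
    by (rule face_polys_AE_zero[OF assms u(1)])
      (use l2_inner_self_eq_0 u face_polys_L2[OF assms] in blast)
qed (auto simp: face_polys_spanned l2_inner_commute)

section \<open>Hybrid spaces and the bilinear form\<close>

text \<open>Linear combinations of hybrid functions, formed componentwise; a whole index set is
  allowed because the application is the expansion in coordinates.\<close>

definition hlin :: "'i set \<Rightarrow> ('i \<Rightarrow> real) \<Rightarrow> ('i \<Rightarrow> hybrid) \<Rightarrow> hybrid" where
  "hlin I c E = Hybrid (\<lambda>K x. \<Sum>i\<in>I. c i * cellp (E i) K x) (\<lambda>F x. \<Sum>i\<in>I. c i * facep (E i) F x)"

lemma hlin_simps: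
  "cellp (hlin I c E) K = (\<lambda>x. \<Sum>i\<in>I. c i * cellp (E i) K x)"
  "facep (hlin I c E) F = (\<lambda>x. \<Sum>i\<in>I. c i * facep (E i) F x)"
  by (auto simp: hlin_def)

lemma VhD:
  assumes "q \<in> Vh m k"
  shows "K \<in> cells m \<Longrightarrow> cellp q K \<in> polys k" "K \<notin> cells m \<Longrightarrow> cellp q K = (\<lambda>x. 0)"
    "F \<in> faces m \<Longrightarrow> facep q F \<in> face_polys k F" "F \<notin> faces m \<Longrightarrow> facep q F = (\<lambda>x. 0)"
  using assms by (auto simp: Vh_def)

lemma hlin_Vh: "(\<And>i. i \<in> I \<Longrightarrow> E i \<in> Vh m k) \<Longrightarrow> hlin I c E \<in> Vh m k"
  unfolding Vh_def hlin_def
  by (auto intro!: fsubspace_sum[OF fsubspace_polys] fsubspace_sum[OF fsubspace_face_polys] sum.neutral)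

locale hho_mesh =
  fixes \<Omega> :: "plane set" and m :: mesh
  assumes finite_cells: "finite (cells m)" and finite_faces: "finite (faces m)"
    and cell: "\<And>K. K \<in> cells m \<Longrightarrow> is_cell K" and face: "\<And>F. F \<in> faces m \<Longrightarrow> is_face F"
    and domain_sets: "\<Omega> \<in> sets lebesgue"
    and interior_cell: "\<And>K. K \<in> cells m \<Longrightarrow> interior K \<subseteq> \<Omega>"
    and interiors_disjoint: "\<And>K K'. K \<in> cells m \<Longrightarrow> K' \<in> cells m \<Longrightarrow> K \<noteq> K' \<Longrightarrow> interior K \<inter> interior K' = {}"
begin

lemma cell_face: "F \<in> cell_faces m K \<Longrightarrow> is_face F" "F \<in> cell_faces m K \<Longrightarrow> F \<in> faces m"
  by (auto simp: cell_faces_def face)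

section \<open>The reconstruction operator\<close>

definition face_gap :: "hybrid \<Rightarrow> plane set \<Rightarrow> plane set \<Rightarrow> plane \<Rightarrow> real" where
  "face_gap q K F = (\<lambda>x. facep q F x - cellp q K x)"

lemma face_gap_L2:
  assumes "q \<in> Vh m k" "K \<in> cells m" "F \<in> faces m"
  shows "face_gap q K F \<in> L2 (face_measure F)"
  unfolding face_gap_def
  using VhD[OF assms(1)] face_polys_L2[OF face] polys_L2_face[OF face] assms
  by (intro fsubspace_diff[OF fsubspace_L2]) blast+

lemma face_gap_hlin: "face_gap (hlin I c E) K F = (\<lambda>x. \<Sum>i\<in>I. c i * face_gap (E i) K F x)"
  by (auto simp: face_gap_def hlin_simps sum_subtractf algebra_simps)

text \<open>The counterpart of \<open>recon_form\<close>: the right-hand side defining the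
  reconstruction, plus the prescribed mean times the mean of the test function.\<close>

definition recon_rhs :: "plane set \<Rightarrow> hybrid \<Rightarrow> (plane \<Rightarrow> real) \<Rightarrow> real" where
  "recon_rhs K q w = grad_inner K (cellp q K) w
     + (\<Sum>F\<in>cell_faces m K. l2_inner (face_measure F) (face_gap q K F) (\<lambda>x. normal K F \<bullet> grad w x))
     + l2_inner (lebesgue_on K) (cellp q K) (\<lambda>x. 1) * l2_inner (lebesgue_on K) w (\<lambda>x. 1)"

lemma normal_grad_L2:
  assumes "w \<in> c1_plane" "is_face F" shows "(\<lambda>x. n \<bullet> grad w x) \<in> L2 (face_measure F)"
  using c1_grad(2)[OF assms(1)] by (intro face_L2_continuous assms continuous_intros)

lemma cell_one_L2: "K \<in> cells m \<Longrightarrow> (\<lambda>x. 1) \<in> L2 (lebesgue_on K)"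
  by (intro cell_L2 cell continuous_intros)

lemma recon_rhs_flinear:
  assumes q: "q \<in> Vh m k" and K: "K \<in> cells m"
  shows "flinear (polys l) (recon_rhs K q)"
  unfolding flinear_def
proof (intro ballI allI)
  fix u v a b assume "u \<in> polys l" "v \<in> polys l"
  then have u: "u \<in> c1_plane" "u \<in> L2 (lebesgue_on K)" and v: "v \<in> c1_plane" "v \<in> L2 (lebesgue_on K)"
    using polys_c1 polys_L2_cell[OF cell[OF K]] by blast+
  have qc: "cellp q K \<in> c1_plane" using VhD(1)[OF q K] polys_c1 by blast
  have 1: "grad_inner K (cellp q K) (\<lambda>x. a * u x + b * v x)
      = a * grad_inner K (cellp q K) u + b * grad_inner K (cellp q K) v"
    by (rule flinearD[OF flinear_grad_inner'[OF cell[OF K] qc] u(1) v(1)])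
  have 2: "l2_inner (face_measure F) (face_gap q K F) (\<lambda>x. n \<bullet> grad (\<lambda>x. a * u x + b * v x) x)
      = a * l2_inner (face_measure F) (face_gap q K F) (\<lambda>x. n \<bullet> grad u x)
      + b * l2_inner (face_measure F) (face_gap q K F) (\<lambda>x. n \<bullet> grad v x)"
    if "F \<in> cell_faces m K" for F n
  proof -
    note F = cell_face[OF that]
    have "l2_inner (face_measure F) (face_gap q K F) (\<lambda>x. a * (n \<bullet> grad u x) + b * (n \<bullet> grad v x))
      = a * l2_inner (face_measure F) (face_gap q K F) (\<lambda>x. n \<bullet> grad u x)
      + b * l2_inner (face_measure F) (face_gap q K F) (\<lambda>x. n \<bullet> grad v x)"
      by (rule flinearD[OF flinear_l2_inner'[OF face_gap_L2[OF q K F(2)]]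
          normal_grad_L2[OF u(1) F(1)] normal_grad_L2[OF v(1) F(1)]])
    then show ?thesis by (simp add: grad_comb[OF u(1) v(1)] inner_add_right)
  qed
  have 3: "l2_inner (lebesgue_on K) (\<lambda>x. a * u x + b * v x) (\<lambda>x. 1)
      = a * l2_inner (lebesgue_on K) u (\<lambda>x. 1) + b * l2_inner (lebesgue_on K) v (\<lambda>x. 1)"
    by (rule flinearD[OF flinear_l2_inner[OF cell_one_L2[OF K]] u(2) v(2)])
  have "(\<Sum>F\<in>cell_faces m K. l2_inner (face_measure F) (face_gap q K F)
        (\<lambda>x. normal K F \<bullet> grad (\<lambda>x. a * u x + b * v x) x))
      = a * (\<Sum>F\<in>cell_faces m K. l2_inner (face_measure F) (face_gap q K F) (\<lambda>x. normal K F \<bullet> grad u x))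
      + b * (\<Sum>F\<in>cell_faces m K. l2_inner (face_measure F) (face_gap q K F) (\<lambda>x. normal K F \<bullet> grad v x))"
    by (simp add: 2 sum.distrib sum_distrib_left)
  with 1 3 show "recon_rhs K q (\<lambda>x. a * u x + b * v x) = a * recon_rhs K q u + b * recon_rhs K q v"
    by (simp add: recon_rhs_def algebra_simps)
qed

abbreviation recon_rep :: "nat \<Rightarrow> plane set \<Rightarrow> ((plane \<Rightarrow> real) \<Rightarrow> real) \<Rightarrow> plane \<Rightarrow> real" where
  "recon_rep k K \<equiv> definite_form.rep (polys (k + 1)) (recon_form K)"

text \<open>Testing the combined equation with the constant 1 removes every gradient and leaves the
  two means times the measure of the cell. Once the means agree, the mean terms cancel for all test
  functions. Conversely, the two defining conditions add up to the combined equation, so uniqueness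
  transfers.\<close>

lemma recon_eq:
  assumes q: "q \<in> Vh m k" and K: "K \<in> cells m"
  shows "recon m k K q = recon_rep k K (recon_rhs K q)"
proof -
  let ?k = "k + 1"
  interpret definite_form "SIGMA i:{..?k}. {..?k - i}" "\<lambda>(i, j) x. x $ 1 ^ i * x $ 2 ^ j" "polys ?k"
    "recon_form K" by (rule recon_form[OF cell[OF K]])
  let ?r = "rep (recon_rhs K q)"
  let ?one = "l2_inner (lebesgue_on K) (\<lambda>x. 1) (\<lambda>x. 1)"
  let ?spec = "\<lambda>r. r \<in> polys (k + 1) \<and>
     (\<forall>w\<in>polys (k + 1).
        grad_inner K r w = grad_inner K (cellp q K) w +
          (\<Sum>F\<in>cell_faces m K. l2_inner (face_measure F)
             (\<lambda>x. facep q F x - cellp q K x) (\<lambda>x. normal K F \<bullet> grad w x))) \<and>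
     l2_inner (lebesgue_on K) r (\<lambda>x. 1) = l2_inner (lebesgue_on K) (cellp q K) (\<lambda>x. 1)"
  have r: "?r \<in> polys ?k" "\<And>w. w \<in> polys ?k \<Longrightarrow> recon_form K ?r w = recon_rhs K q w"
    using rep_in rep_eq recon_rhs_flinear[OF q K] by blast+
  have zero: "l2_inner (face_measure F) u (\<lambda>x. 0) = 0" for F u
    by (simp add: l2_inner_def)
  have "recon_form K ?r (\<lambda>x. 1) = recon_rhs K q (\<lambda>x. 1)"
    by (rule r(2)[OF const_in_polys])
  then have "l2_inner (lebesgue_on K) ?r (\<lambda>x. 1) * ?one = l2_inner (lebesgue_on K) (cellp q K) (\<lambda>x. 1) * ?one"
    unfolding recon_form_def recon_rhs_def by (simp add: grad_inner_def grad_const zero)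
  then have mean: "l2_inner (lebesgue_on K) ?r (\<lambda>x. 1) = l2_inner (lebesgue_on K) (cellp q K) (\<lambda>x. 1)"
    using l2_inner_const_pos[OF cell[OF K]] by simp
  have "?spec ?r"
    using r mean unfolding recon_form_def recon_rhs_def face_gap_def by auto
  moreover have "r' = ?r" if "?spec r'" for r'
    using that by (intro rep_eqI[symmetric]) (auto simp: recon_form_def recon_rhs_def face_gap_def)
  ultimately show ?thesis unfolding recon_def by (rule the_equality)
qed

lemma recon_polys:
  assumes "q \<in> Vh m k" "K \<in> cells m" shows "recon m k K q \<in> polys (k + 1)"
  unfolding recon_eq[OF assms]
  by (rule definite_form.rep_in[OF recon_form[OF cell[OF assms(2)]] recon_rhs_flinear[OF assms]])

text \<open>The right-hand side is linear in the hybrid function term by term (gradient, face gaps,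
  mean), and the representer is linear in the right-hand side.\<close>

lemma recon_hlin:
  assumes E: "\<And>i. i \<in> I \<Longrightarrow> E i \<in> Vh m k" and K: "K \<in> cells m"
  shows "recon m k K (hlin I c E) = (\<lambda>x. \<Sum>i\<in>I. c i * recon m k K (E i) x)"
proof -
  have "recon_rhs K (hlin I c E) w = (\<Sum>i\<in>I. c i * recon_rhs K (E i) w)" if w: "w \<in> polys (k + 1)" for w
  proof -
    have wc: "w \<in> c1_plane" using w polys_c1 by blast
    have Ec: "cellp (E i) K \<in> c1_plane" "cellp (E i) K \<in> L2 (lebesgue_on K)" if "i \<in> I" for i
      using VhD(1)[OF E[OF that] K] polys_c1 polys_L2_cell[OF cell[OF K]] by blast+
    have 1: "grad_inner K (cellp (hlin I c E) K) w = (\<Sum>i\<in>I. c i * grad_inner K (cellp (E i) K) w)"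
      unfolding hlin_simps by (rule flinear_sum[OF fsubspace_c1 flinear_grad_inner[OF cell[OF K] wc] Ec(1)])
    have 2: "l2_inner (face_measure F) (face_gap (hlin I c E) K F) (\<lambda>x. normal K F \<bullet> grad w x)
        = (\<Sum>i\<in>I. c i * l2_inner (face_measure F) (face_gap (E i) K F) (\<lambda>x. normal K F \<bullet> grad w x))"
      if "F \<in> cell_faces m K" for F
      unfolding face_gap_hlin
      by (intro flinear_sum[OF fsubspace_L2 flinear_l2_inner] normal_grad_L2 wc cell_face[OF that]
          face_gap_L2[where k = k] E K)
    have 3: "l2_inner (lebesgue_on K) (cellp (hlin I c E) K) (\<lambda>x. 1)
        = (\<Sum>i\<in>I. c i * l2_inner (lebesgue_on K) (cellp (E i) K) (\<lambda>x. 1))"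
      unfolding hlin_simps by (rule flinear_sum[OF fsubspace_L2 flinear_l2_inner[OF cell_one_L2[OF K]] Ec(2)])
    have "(\<Sum>F\<in>cell_faces m K. l2_inner (face_measure F) (face_gap (hlin I c E) K F) (\<lambda>x. normal K F \<bullet> grad w x))
        = (\<Sum>i\<in>I. c i * (\<Sum>F\<in>cell_faces m K. l2_inner (face_measure F) (face_gap (E i) K F)
            (\<lambda>x. normal K F \<bullet> grad w x)))"
      by (simp add: 2 sum_distrib_left sum.swap[of _ I])
    with 1 3 show ?thesis
      by (simp add: recon_rhs_def sum.distrib distrib_left sum_distrib_right mult.assoc)
  qed
  then have "recon_rep k K (recon_rhs K (hlin I c E))
      = (\<lambda>x. \<Sum>i\<in>I. c i * recon_rep k K (recon_rhs K (E i)) x)"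
    by (intro definite_form.rep_sum[OF recon_form[OF cell[OF K]]] recon_rhs_flinear[OF E K])
  moreover have "recon_rep k K (recon_rhs K (E i)) = recon m k K (E i)" if "i \<in> I" for i
    using recon_eq[OF E[OF that] K] by simp
  moreover have "recon m k K (hlin I c E) = recon_rep k K (recon_rhs K (hlin I c E))"
    by (intro recon_eq hlin_Vh E K)
  ultimately show ?thesis by simp
qed

section \<open>Projections on cells and faces\<close>

lemma proj_cell_rep: "proj_cell k K u = definite_form.rep (polys k) (l2_inner (lebesgue_on K)) (l2_inner (lebesgue_on K) u)"
  if "K \<in> cells m" for K
  unfolding proj_cell_def l2_proj_def definite_form.rep_def[OF proj_cell_form[OF cell[OF that]]] ..

lemma proj_cell:
  assumes "u \<in> L2 (lebesgue_on K)" "K \<in> cells m"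
  shows "proj_cell k K u \<in> polys k"
    "w \<in> polys k \<Longrightarrow> l2_inner (lebesgue_on K) (proj_cell k K u) w = l2_inner (lebesgue_on K) u w"
proof -
  have "flinear (polys k) (l2_inner (lebesgue_on K) u)"
    by (rule flinear_subset[OF flinear_l2_inner'[OF assms(1)] polys_L2_cell[OF cell[OF assms(2)]]])
  from definite_form.rep[OF proj_cell_form[OF cell[OF assms(2)]] this]
  show "proj_cell k K u \<in> polys k"
    "w \<in> polys k \<Longrightarrow> l2_inner (lebesgue_on K) (proj_cell k K u) w = l2_inner (lebesgue_on K) u w"
    by (simp_all add: proj_cell_rep[OF assms(2)])
qed

lemma proj_cell_sum:
  assumes "\<And>i. i \<in> I \<Longrightarrow> u i \<in> L2 (lebesgue_on K)" "K \<in> cells m"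
  shows "proj_cell k K (\<lambda>x. \<Sum>i\<in>I. c i * u i x) = (\<lambda>x. \<Sum>i\<in>I. c i * proj_cell k K (u i) x)"
  unfolding proj_cell_rep[OF assms(2)]
proof (rule definite_form.rep_sum[OF proj_cell_form[OF cell[OF assms(2)]]])
  show "flinear (polys k) (l2_inner (lebesgue_on K) (u i))" if "i \<in> I" for i
    by (rule flinear_subset[OF flinear_l2_inner'[OF assms(1)[OF that]] polys_L2_cell[OF cell[OF assms(2)]]])
  show "l2_inner (lebesgue_on K) (\<lambda>x. \<Sum>i\<in>I. c i * u i x) w = (\<Sum>i\<in>I. c i * l2_inner (lebesgue_on K) (u i) w)"
    if "w \<in> polys k" for w
    by (rule flinear_sum[OF fsubspace_L2 flinear_l2_inner assms(1)])
      (use that polys_L2_cell[OF cell[OF assms(2)]] in auto)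
qed

lemma proj_face_rep: "proj_face k F u = definite_form.rep (face_polys k F) (l2_inner (face_measure F)) (l2_inner (face_measure F) u)"
  if "F \<in> faces m" for F
  unfolding proj_face_def l2_proj_def definite_form.rep_def[OF proj_face_form[OF face[OF that]]] ..

lemma proj_face_in:
  assumes "u \<in> L2 (face_measure F)" "F \<in> faces m"
  shows "proj_face k F u \<in> face_polys k F"
  unfolding proj_face_rep[OF assms(2)]
  by (intro definite_form.rep_in[OF proj_face_form[OF face[OF assms(2)]]]
      flinear_subset[OF flinear_l2_inner'[OF assms(1)] face_polys_L2[OF face[OF assms(2)]]])

lemma proj_face_sum:
  assumes "\<And>i. i \<in> I \<Longrightarrow> u i \<in> L2 (face_measure F)" "F \<in> faces m"
  shows "proj_face k F (\<lambda>x. \<Sum>i\<in>I. c i * u i x) = (\<lambda>x. \<Sum>i\<in>I. c i * proj_face k F (u i) x)"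
  unfolding proj_face_rep[OF assms(2)]
proof (rule definite_form.rep_sum[OF proj_face_form[OF face[OF assms(2)]]])
  show "flinear (face_polys k F) (l2_inner (face_measure F) (u i))" if "i \<in> I" for i
    by (rule flinear_subset[OF flinear_l2_inner'[OF assms(1)[OF that]] face_polys_L2[OF face[OF assms(2)]]])
  show "l2_inner (face_measure F) (\<lambda>x. \<Sum>i\<in>I. c i * u i x) w = (\<Sum>i\<in>I. c i * l2_inner (face_measure F) (u i) w)"
    if "w \<in> face_polys k F" for w
    by (rule flinear_sum[OF fsubspace_L2 flinear_l2_inner assms(1)])
      (use that face_polys_L2[OF face[OF assms(2)]] in auto)
qed

section \<open>Stabilization and the bilinear form\<close>

definition jump :: "nat \<Rightarrow> plane set \<Rightarrow> plane set \<Rightarrow> hybrid \<Rightarrow> plane \<Rightarrow> real" where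
  "jump k K F q = (\<lambda>x. delta_face m k K F q x - delta_cell m k K q x)"

lemma recon_diff_cell_L2:
  assumes "q \<in> Vh m k" "K \<in> cells m"
  shows "(\<lambda>x. recon m k K q x - cellp q K x) \<in> L2 (lebesgue_on K)"
  using recon_polys[OF assms] VhD(1)[OF assms] polys_L2_cell[OF cell[OF assms(2)]]
  by (intro fsubspace_diff[OF fsubspace_L2]) blast+

lemma recon_diff_face_L2:
  assumes "q \<in> Vh m k" "K \<in> cells m" "F \<in> faces m"
  shows "(\<lambda>x. recon m k K q x - facep q F x) \<in> L2 (face_measure F)"
  using recon_polys[OF assms(1,2)] VhD(3)[OF assms(1,3)] polys_L2_face[OF face[OF assms(3)]]
    face_polys_L2[OF face[OF assms(3)]]
  by (intro fsubspace_diff[OF fsubspace_L2]) blast+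

lemma jump_L2:
  assumes "q \<in> Vh m k" "K \<in> cells m" "F \<in> faces m"
  shows "jump k K F q \<in> L2 (face_measure F)"
  unfolding jump_def delta_face_def delta_cell_def
  using proj_face_in[OF recon_diff_face_L2[OF assms] assms(3)]
    proj_cell(1)[OF recon_diff_cell_L2[OF assms(1,2)] assms(2)]
    polys_L2_face[OF face[OF assms(3)]] face_polys_L2[OF face[OF assms(3)]]
  by (intro fsubspace_diff[OF fsubspace_L2]) blast+

lemma jump_hlin:
  assumes E: "\<And>i. i \<in> I \<Longrightarrow> E i \<in> Vh m k" and K: "K \<in> cells m" and F: "F \<in> faces m"
  shows "jump k K F (hlin I c E) = (\<lambda>x. \<Sum>i\<in>I. c i * jump k K F (E i) x)"
proof -
  have "(\<lambda>x. recon m k K (hlin I c E) x - facep (hlin I c E) F x)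
      = (\<lambda>x. \<Sum>i\<in>I. c i * (recon m k K (E i) x - facep (E i) F x))"
    by (simp add: recon_hlin[OF E K] hlin_simps right_diff_distrib sum_subtractf)
  then have f: "delta_face m k K F (hlin I c E) = (\<lambda>x. \<Sum>i\<in>I. c i * delta_face m k K F (E i) x)"
    unfolding delta_face_def by (simp only:) (intro proj_face_sum recon_diff_face_L2 E K F)
  have "(\<lambda>x. recon m k K (hlin I c E) x - cellp (hlin I c E) K x)
      = (\<lambda>x. \<Sum>i\<in>I. c i * (recon m k K (E i) x - cellp (E i) K x))"
    by (simp add: recon_hlin[OF E K] hlin_simps right_diff_distrib sum_subtractf)
  then have c: "delta_cell m k K (hlin I c E) = (\<lambda>x. \<Sum>i\<in>I. c i * delta_cell m k K (E i) x)"
    unfolding delta_cell_def by (simp only:) (intro proj_cell_sum recon_diff_cell_L2 E K)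
  show ?thesis unfolding jump_def f c by (simp add: right_diff_distrib sum_subtractf)
qed

text \<open>Gathered cell by cell, every term is an inner product of quantities linear in the hybrid
  function, so symmetry, positivity and linearity can be checked termwise.\<close>

lemma bh_jump:
  "bh m k q r = (\<Sum>K\<in>cells m. grad_inner K (recon m k K q) (recon m k K r)
     + (\<Sum>F\<in>cell_faces m K. inverse (diameter F) * l2_inner (face_measure F) (jump k K F q) (jump k K F r)))"
  by (simp add: bh_def stab_cell_def jump_def sum.distrib)

lemma bh_commute: "bh m k q r = bh m k r q"
  unfolding bh_jump by (simp add: grad_inner_commute l2_inner_commute)

lemma bh_nonneg: "0 \<le> bh m k q q"
  unfolding bh_jump
  by (intro sum_nonneg add_nonneg_nonneg mult_nonneg_nonneg grad_inner_nonneg l2_inner_nonneg)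
    (use cell_face compact_face in \<open>auto intro!: diameter_ge_0 compact_imp_bounded\<close>)

lemma norm_1h_sq: "(norm_1h m k q)\<^sup>2 = bh m k q q"
  by (simp add: norm_1h_def bh_nonneg)

lemma bh_hlin:
  assumes E: "\<And>i. i \<in> I \<Longrightarrow> E i \<in> Vh m k" and r: "r \<in> Vh m k"
  shows "bh m k (hlin I c E) r = (\<Sum>i\<in>I. c i * bh m k (E i) r)"
proof -
  have "grad_inner K (recon m k K (hlin I c E)) (recon m k K r)
      + (\<Sum>F\<in>cell_faces m K. inverse (diameter F)
          * l2_inner (face_measure F) (jump k K F (hlin I c E)) (jump k K F r))
      = (\<Sum>i\<in>I. c i * (grad_inner K (recon m k K (E i)) (recon m k K r)
      + (\<Sum>F\<in>cell_faces m K. inverse (diameter F)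
          * l2_inner (face_measure F) (jump k K F (E i)) (jump k K F r))))"
    if K: "K \<in> cells m" for K
  proof -
    have c1: "recon m k K q \<in> c1_plane" if "q \<in> Vh m k" for q
      using recon_polys[OF that K] polys_c1 by blast
    have g: "grad_inner K (recon m k K (hlin I c E)) (recon m k K r)
        = (\<Sum>i\<in>I. c i * grad_inner K (recon m k K (E i)) (recon m k K r))"
      using flinear_sum[OF fsubspace_c1 flinear_grad_inner[OF cell[OF K] c1[OF r]] c1[OF E], of I "\<lambda>i. i" c]
      by (simp only: recon_hlin[OF E K])
    have j: "l2_inner (face_measure F) (jump k K F (hlin I c E)) (jump k K F r)
        = (\<Sum>i\<in>I. c i * l2_inner (face_measure F) (jump k K F (E i)) (jump k K F r))"
      if "F \<in> cell_faces m K" for F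
    proof -
      note F = cell_face(2)[OF that]
      show ?thesis
        using flinear_sum[OF fsubspace_L2 flinear_l2_inner[OF jump_L2[OF r K F]] jump_L2[OF E K F], of I "\<lambda>i. i" c]
        by (simp only: jump_hlin[OF E K F])
    qed
    have "(\<Sum>F\<in>cell_faces m K. inverse (diameter F)
          * l2_inner (face_measure F) (jump k K F (hlin I c E)) (jump k K F r))
        = (\<Sum>i\<in>I. c i * (\<Sum>F\<in>cell_faces m K. inverse (diameter F)
          * l2_inner (face_measure F) (jump k K F (E i)) (jump k K F r)))"
      by (simp add: j sum_distrib_left sum.swap[of _ I] mult.left_commute)
    with g show ?thesis by (simp add: distrib_left sum.distrib)
  qed
  then show ?thesis
    unfolding bh_jump by (simp add: sum_distrib_left sum.swap[of _ I])
qed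

text \<open>The energy argument sees \<open>bh\<close> only through this Gram matrix.\<close>

lemma bh_hlin2:
  assumes E: "\<And>i. i \<in> I \<Longrightarrow> E i \<in> Vh m k"
  shows "bh m k (hlin I c E) (hlin I d E) = (\<Sum>i\<in>I. \<Sum>j\<in>I. c i * d j * bh m k (E i) (E j))"
proof -
  have "bh m k (E i) (hlin I d E) = (\<Sum>j\<in>I. d j * bh m k (E i) (E j))" if "i \<in> I" for i
    unfolding bh_commute[of k "E i"] by (rule bh_hlin[OF E E[OF that]])
  then show ?thesis
    by (simp add: bh_hlin[OF E hlin_Vh[OF E]] sum_distrib_left mult.assoc)
qed

section \<open>The mass form\<close>

lemma cell_domain_AE:
  assumes K: "K \<in> cells m"
  shows "AE x in lebesgue. indicat_real \<Omega> x *\<^sub>R (indicat_real (interior K) x * h x) = indicat_real K x *\<^sub>R h x"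
proof -
  have "AE x in lebesgue. x \<notin> frontier K"
    using cell[OF K] by (auto simp: is_cell_def negligible_iff_null_sets intro: AE_not_in)
  then show ?thesis
  proof (rule AE_mp, intro AE_I2 impI)
    fix x assume "x \<notin> frontier K"
    then have "x \<in> K \<longleftrightarrow> x \<in> interior K"
      using closure_subset[of K] interior_subset[of K] by (auto simp: frontier_def)
    then show "indicat_real \<Omega> x *\<^sub>R (indicat_real (interior K) x * h x) = indicat_real K x *\<^sub>R h x"
      using interior_cell[OF K] by (auto simp: indicator_def)
  qed
qed

text \<open>A cell may leave \<Omega> along the boundary, so a function on \<Omega> cannot simply be
  restricted to it. Instead the zero extensions from \<Omega>, localized to the interior of the
  cell, and from the cell agree almost everywhere; completeness of Lebesgue measure then gives
  measurability on the cell.\<close>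

lemma domain_cell:
  assumes K: "K \<in> cells m" and h: "h \<in> borel_measurable (lebesgue_on \<Omega>)"
  shows "h \<in> borel_measurable (lebesgue_on K)"
    "integrable (lebesgue_on \<Omega>) h \<Longrightarrow> integrable (lebesgue_on K) h"
    "(LINT x|lebesgue_on \<Omega>. indicat_real (interior K) x * h x) = (LINT x|lebesgue_on K. h x)"
proof -
  note ae = cell_domain_AE[OF K, of h]
  have i: "indicat_real (interior K) \<in> borel_measurable (lebesgue_on \<Omega>)"
    by (intro measurable_restrict_space1 measurable_completion) auto
  have m1: "(\<lambda>x. indicat_real \<Omega> x *\<^sub>R (indicat_real (interior K) x * h x)) \<in> borel_measurable lebesgue"
    using borel_measurable_times[OF i h] domain_sets by (subst (asm) borel_measurable_restrict_space_iff) auto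
  then have m2: "(\<lambda>x. indicat_real K x *\<^sub>R h x) \<in> borel_measurable lebesgue"
    by (rule borel_measurable_AE[OF _ ae])
  then show "h \<in> borel_measurable (lebesgue_on K)"
    using cell_sets[OF cell[OF K]] by (subst borel_measurable_restrict_space_iff) auto
  show "integrable (lebesgue_on K) h" if "integrable (lebesgue_on \<Omega>) h"
  proof -
    have "interior K \<inter> \<Omega> \<in> sets (lebesgue_on \<Omega>)"
      unfolding sets_restrict_space by (intro image_eqI[of _ _ "interior K"]) auto
    then have "integrable (lebesgue_on \<Omega>) (\<lambda>x. indicat_real (interior K \<inter> \<Omega>) x *\<^sub>R h x)"
      using that by (intro integrable_mult_indicator)
    then have "integrable lebesgue (\<lambda>x. indicat_real \<Omega> x *\<^sub>R (indicat_real (interior K \<inter> \<Omega>) x *\<^sub>R h x))"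
      using domain_sets by (subst (asm) integrable_restrict_space) auto
    moreover have "indicat_real \<Omega> x *\<^sub>R (indicat_real (interior K \<inter> \<Omega>) x *\<^sub>R h x)
        = indicat_real \<Omega> x *\<^sub>R (indicat_real (interior K) x * h x)" for x
      by (auto simp: indicator_def)
    ultimately have "integrable lebesgue (\<lambda>x. indicat_real K x *\<^sub>R h x)"
      using integrable_cong_AE[OF m1 m2 ae] by (simp only:)
    then show ?thesis using cell_sets[OF cell[OF K]] by (subst integrable_restrict_space) auto
  qed
  show "(LINT x|lebesgue_on \<Omega>. indicat_real (interior K) x * h x) = (LINT x|lebesgue_on K. h x)"
    using integral_cong_AE[OF m1 m2 ae] domain_sets cell_sets[OF cell[OF K]]
    by (simp add: integral_restrict_space)
qed

lemma domain_cell_L2: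
  assumes "K \<in> cells m" "u \<in> L2 (lebesgue_on \<Omega>)" shows "u \<in> L2 (lebesgue_on K)"
proof -
  have u: "u \<in> borel_measurable (lebesgue_on \<Omega>)" "integrable (lebesgue_on \<Omega>) (\<lambda>x. (u x)\<^sup>2)"
    using assms(2) by (simp_all add: L2_def)
  have "u \<in> borel_measurable (lebesgue_on K)" by (rule domain_cell(1)[OF assms(1) u(1)])
  moreover have "integrable (lebesgue_on K) (\<lambda>x. (u x)\<^sup>2)"
    by (rule domain_cell(2)[OF assms(1) borel_measurable_integrable[OF u(2)] u(2)])
  ultimately show ?thesis by (simp add: L2_def)
qed

lemma cell_poly_L2:
  assumes K: "K \<in> cells m" and q: "q \<in> polys k"
  shows "(\<lambda>x. indicat_real (interior K) x * q x) \<in> L2 (lebesgue_on \<Omega>)"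
proof -
  have qm: "q \<in> borel_measurable borel"
    using polys_continuous[OF q] by (rule borel_measurable_continuous_onI)
  have m0: "(\<lambda>x. indicat_real (interior K) x * q x) \<in> borel_measurable borel"
    using qm by measurable
  have m1: "(\<lambda>x. indicat_real (interior K) x * q x) \<in> borel_measurable lebesgue"
    using m0 by (simp add: measurable_completion)
  have "integrable (lebesgue_on K) (\<lambda>x. (q x)\<^sup>2)"
    using polys_L2_cell[OF cell[OF K]] q by (auto simp: L2_def)
  then have "integrable lebesgue (\<lambda>x. indicat_real K x *\<^sub>R (q x)\<^sup>2)"
    using cell_sets[OF cell[OF K]] by (subst (asm) integrable_restrict_space) auto
  then have "integrable lebesgue (\<lambda>x. indicat_real \<Omega> x *\<^sub>R (indicat_real (interior K) x * q x)\<^sup>2)"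
  proof (rule Bochner_Integration.integrable_bound)
    show "(\<lambda>x. indicat_real \<Omega> x *\<^sub>R (indicat_real (interior K) x * q x)\<^sup>2) \<in> borel_measurable lebesgue"
      using m1 domain_sets by measurable
  qed (use interior_subset in \<open>auto simp: indicator_def\<close>)
  then have "integrable (lebesgue_on \<Omega>) (\<lambda>x. (indicat_real (interior K) x * q x)\<^sup>2)"
    using domain_sets by (subst integrable_restrict_space) auto
  then show ?thesis using m1 by (auto simp: L2_def intro: measurable_restrict_space1)
qed

lemma broken_L2:
  assumes "\<And>K. K \<in> cells m \<Longrightarrow> v K \<in> polys k"
  shows "broken m v \<in> L2 (lebesgue_on \<Omega>)"
proof -
  have "(\<lambda>x. \<Sum>K\<in>cells m. 1 * (indicat_real (interior K) x * v K x)) \<in> L2 (lebesgue_on \<Omega>)"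
    by (intro fsubspace_sum[OF fsubspace_L2] cell_poly_L2[where k = k] assms)
  then show ?thesis by (simp add: broken_def[abs_def])
qed

lemma l2_inner_broken:
  assumes u: "u \<in> L2 (lebesgue_on \<Omega>)" and v: "\<And>K. K \<in> cells m \<Longrightarrow> v K \<in> polys k"
  shows "l2_inner (lebesgue_on \<Omega>) u (broken m v) = (\<Sum>K\<in>cells m. l2_inner (lebesgue_on K) u (v K))"
proof -
  have "l2_inner (lebesgue_on \<Omega>) u (\<lambda>x. \<Sum>K\<in>cells m. 1 * (indicat_real (interior K) x * v K x))
      = (\<Sum>K\<in>cells m. 1 * l2_inner (lebesgue_on \<Omega>) u (\<lambda>x. indicat_real (interior K) x * v K x))"
    by (intro flinear_sum[OF fsubspace_L2 flinear_l2_inner'] u cell_poly_L2[where k = k] v)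
  moreover have "l2_inner (lebesgue_on \<Omega>) u (\<lambda>x. indicat_real (interior K) x * v K x)
      = l2_inner (lebesgue_on K) u (v K)" if K: "K \<in> cells m" for K
  proof -
    have "v K \<in> borel_measurable (lebesgue_on \<Omega>)"
      using borel_measurable_continuous_onI[OF polys_continuous[OF v[OF K]]]
      by (intro measurable_restrict_space1 measurable_completion) auto
    then have "(\<lambda>x. u x * v K x) \<in> borel_measurable (lebesgue_on \<Omega>)" using u by (auto simp: L2_def)
    from domain_cell(3)[OF K this] show ?thesis by (simp add: l2_inner_def mult.left_commute)
  qed
  ultimately show ?thesis by (simp add: broken_def[abs_def])
qed

lemma broken_interior:
  assumes "K \<in> cells m" "x \<in> interior K" shows "broken m v x = v K x"
proof -
  have "broken m v x = (\<Sum>K'\<in>cells m. if K' = K then v K x else 0)"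
    unfolding broken_def using interiors_disjoint assms
    by (intro sum.cong) (auto simp: indicator_def)
  then show ?thesis using assms finite_cells by simp
qed

text \<open>After the reduction to cells one factor is still the whole broken polynomial; as the
  interiors are disjoint, it coincides with its own component off the null frontier.\<close>

lemma l2_inner_broken_broken:
  assumes u: "\<And>K. K \<in> cells m \<Longrightarrow> u K \<in> polys k" and v: "\<And>K. K \<in> cells m \<Longrightarrow> v K \<in> polys l"
  shows "l2_inner (lebesgue_on \<Omega>) (broken m u) (broken m v) = (\<Sum>K\<in>cells m. l2_inner (lebesgue_on K) (u K) (v K))"
proof (subst l2_inner_broken[OF broken_L2[OF u] v]; (rule sum.cong[OF refl])?)
  fix K assume K: "K \<in> cells m"
  have bu: "broken m u \<in> L2 (lebesgue_on K)"
    by (rule domain_cell_L2[OF K broken_L2[where k = k]]) (rule u)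
  have uK: "u K \<in> L2 (lebesgue_on K)" and vK: "v K \<in> L2 (lebesgue_on K)"
    using u[OF K] v[OF K] polys_L2_cell[OF cell[OF K]] by blast+
  have "AE x in lebesgue. x \<notin> frontier K"
    using cell[OF K] by (auto simp: is_cell_def negligible_iff_null_sets intro: AE_not_in)
  then have "AE x in lebesgue. x \<in> K \<longrightarrow> broken m u x * v K x = u K x * v K x"
  proof (rule AE_mp, intro AE_I2 impI)
    fix x assume "x \<notin> frontier K" "x \<in> K"
    then have "x \<in> interior K" using closure_subset[of K] by (auto simp: frontier_def)
    then show "broken m u x * v K x = u K x * v K x" by (simp add: broken_interior[OF K])
  qed
  then have "AE x in lebesgue_on K. broken m u x * v K x = u K x * v K x"
    using cell_sets[OF cell[OF K]] by (subst AE_restrict_space_iff) auto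
  then show "l2_inner (lebesgue_on K) (broken m u) (v K) = l2_inner (lebesgue_on K) (u K) (v K)"
    unfolding l2_inner_def using bu uK vK by (intro integral_cong_AE) (auto simp: L2_def)
qed

text \<open>The squared norm of the broken projection equals its inner product with
  \<open>g\<close>, and Young's inequality with weight 1 bounds twice that by the sum of the squared
  norms. Working on \<Omega> avoids splitting the norm of \<open>g\<close> over the cells.\<close>

lemma proj_cell_norm_le:
  assumes g: "g \<in> L2 (lebesgue_on \<Omega>)"
  shows "(\<Sum>K\<in>cells m. l2_inner (lebesgue_on K) (proj_cell k K g) (proj_cell k K g))
    \<le> (l2_norm (lebesgue_on \<Omega>) g)\<^sup>2"
proof -
  let ?b = "broken m (\<lambda>K. proj_cell k K g)"
  have p: "proj_cell k K g \<in> polys k"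
    "l2_inner (lebesgue_on K) (proj_cell k K g) (proj_cell k K g) = l2_inner (lebesgue_on K) g (proj_cell k K g)"
    if "K \<in> cells m" for K
    using proj_cell[OF domain_cell_L2[OF that g] that] by blast+
  have bb: "l2_inner (lebesgue_on \<Omega>) ?b ?b
      = (\<Sum>K\<in>cells m. l2_inner (lebesgue_on K) (proj_cell k K g) (proj_cell k K g))"
    by (rule l2_inner_broken_broken[OF p(1) p(1)])
  also have "\<dots> = l2_inner (lebesgue_on \<Omega>) g ?b"
    by (subst l2_inner_broken[where k = k, OF g]) (auto intro!: p(1) sum.cong p(2))
  moreover have "?b \<in> L2 (lebesgue_on \<Omega>)" by (intro broken_L2[where k = k] p(1))
  ultimately have "2 * (l2_norm (lebesgue_on \<Omega>) ?b)\<^sup>2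
      \<le> 1 * (l2_norm (lebesgue_on \<Omega>) g)\<^sup>2 + (l2_norm (lebesgue_on \<Omega>) ?b)\<^sup>2 / 1"
    unfolding l2_norm_sq[of _ ?b]
    using l2_inner_young[OF g, of ?b 1] by (simp add: l2_norm_sq)
  then have "(l2_norm (lebesgue_on \<Omega>) ?b)\<^sup>2 \<le> (l2_norm (lebesgue_on \<Omega>) g)\<^sup>2" by simp
  then show ?thesis by (simp only: l2_norm_sq bb)
qed

section \<open>Nodal coordinates of hybrid functions\<close>

text \<open>An index is a cell or a face together with the number of a node. Recording that each
  \<open>N i\<close> is a point evaluation lets continuity and integrability in time be read off
  from \<open>hybrid_C1\<close> and \<open>hybrid_integrable\<close>. The cells share their nodes,
  since their polynomials live on the plane; each face has its own.\<close>

lemma Vh_nodal: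
  "\<exists>(I :: (plane set \<times> nat + plane set \<times> nat) set) N E. finite I \<and> (\<forall>i\<in>I. E i \<in> Vh m k) \<and>
    (\<forall>i\<in>I. (\<exists>K\<in>cells m. \<exists>x. N i = (\<lambda>q. cellp q K x)) \<or> (\<exists>F\<in>faces m. \<exists>x. N i = (\<lambda>q. facep q F x))) \<and>
    (\<forall>q\<in>Vh m k. q = hlin I (\<lambda>i. N i q) E)"
proof -
  obtain n x e where e: "\<And>i. i < (n::nat) \<Longrightarrow> e i \<in> polys k"
    and ex: "\<And>w z. w \<in> polys k \<Longrightarrow> w z = (\<Sum>i<n. w (x i) * e i z)"
    using nodal_basis[OF finite_poly_index, of k "\<lambda>(i, j) x::plane. x $ 1 ^ i * x $ 2 ^ j"]
    unfolding polys_spanned[symmetric] by blast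
  have "\<exists>n x e. (\<forall>i<(n::nat). e i \<in> face_polys k F) \<and>
    (\<forall>w\<in>face_polys k F. \<forall>z. w z = (\<Sum>i<n. w (x i) * e i z))" for F
    using nodal_basis[OF finite_poly_index, of k "\<lambda>(i, j) x. indicat_real F x * (x $ 1 ^ i * x $ 2 ^ j)"]
    unfolding face_polys_spanned[symmetric] .
  then have "\<forall>F. \<exists>n x e. (\<forall>i<(n::nat). e i \<in> face_polys k F) \<and>
    (\<forall>w\<in>face_polys k F. \<forall>z. w z = (\<Sum>i<n. w (x i) * e i z))" by blast
  from choice[OF this] obtain nf where "\<forall>F. \<exists>x e. (\<forall>i<(nf F::nat). e i \<in> face_polys k F) \<and>
    (\<forall>w\<in>face_polys k F. \<forall>z. w z = (\<Sum>i<nf F. w (x i) * e i z))" by blast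
  from choice[OF this] obtain xf where "\<forall>F. \<exists>e. (\<forall>i<(nf F::nat). e i \<in> face_polys k F) \<and>
    (\<forall>w\<in>face_polys k F. \<forall>z. w z = (\<Sum>i<nf F. w (xf F i) * e i z))" by blast
  from choice[OF this] obtain ef where ef: "\<And>F i. i < (nf F::nat) \<Longrightarrow> ef F i \<in> face_polys k F"
    and exf: "\<And>F w z. w \<in> face_polys k F \<Longrightarrow> w z = (\<Sum>i<nf F. w (xf F i) * ef F i z)"
    by blast
  define A where "A = cells m \<times> {..<n}"
  define B where "B = (SIGMA F:faces m. {..<nf F})"
  define N where "N = case_sum (\<lambda>(K, i) q. cellp q K (x i)) (\<lambda>(F, i) q. facep q F (xf F i))"
  define E where "E = case_sum
    (\<lambda>(K, i). Hybrid (\<lambda>K'. if K' = K then e i else (\<lambda>x. 0)) (\<lambda>F x. 0))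
    (\<lambda>(F, i). Hybrid (\<lambda>K x. 0) (\<lambda>F'. if F' = F then ef F i else (\<lambda>x. 0)))"
  have fin: "finite A" "finite B" by (auto simp: A_def B_def finite_cells finite_faces)
  have EV: "E i \<in> Vh m k" if "i \<in> A <+> B" for i
    using that e ef
    by (auto simp: E_def A_def B_def Vh_def fsubspace_zero[OF fsubspace_polys] fsubspace_zero[OF fsubspace_face_polys])
  have NN: "(\<exists>K\<in>cells m. \<exists>x. N i = (\<lambda>q. cellp q K x)) \<or> (\<exists>F\<in>faces m. \<exists>x. N i = (\<lambda>q. facep q F x))"
    if "i \<in> A <+> B" for i
  proof (cases i)
    case (Inl p)
    with that have "fst p \<in> cells m" "N i = (\<lambda>q. cellp q (fst p) (x (snd p)))"
      by (auto simp: N_def A_def case_prod_beta)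
    then show ?thesis by blast
  next
    case (Inr p)
    with that have "fst p \<in> faces m" "N i = (\<lambda>q. facep q (fst p) (xf (fst p) (snd p)))"
      by (auto simp: N_def B_def case_prod_beta)
    then show ?thesis by blast
  qed
  have "q = hlin (A <+> B) (\<lambda>i. N i q) E" if q: "q \<in> Vh m k" for q
  proof (rule hybrid.expand, intro conjI)
    show "cellp q = cellp (hlin (A <+> B) (\<lambda>i. N i q) E)"
    proof (intro ext)
      fix K z
      have "cellp (hlin (A <+> B) (\<lambda>i. N i q) E) K z
          = (\<Sum>(K', i)\<in>A. cellp q K' (x i) * (if K = K' then e i z else 0))"
        unfolding hlin_simps sum.Plus[OF fin]
        by (auto simp: E_def N_def case_prod_beta intro!: sum.cong)
      also have "\<dots> = (\<Sum>K'\<in>cells m. \<Sum>i<n. cellp q K' (x i) * (if K = K' then e i z else 0))"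
        unfolding A_def by (rule sum.cartesian_product[symmetric])
      also have "\<dots> = (\<Sum>K'\<in>cells m. if K = K' then \<Sum>i<n. cellp q K (x i) * e i z else 0)"
        by (intro sum.cong) auto
      \<comment> \<open>For \<open>K\<close> outside the mesh no summand survives, in agreement with
        the zero default in \<open>Vh\<close>.\<close>
      also have "\<dots> = cellp q K z"
        using finite_cells ex[OF VhD(1)[OF q], of K z] VhD(2)[OF q, of K] by (auto simp: sum.delta)
      finally show "cellp q K z = cellp (hlin (A <+> B) (\<lambda>i. N i q) E) K z" ..
    qed
    show "facep q = facep (hlin (A <+> B) (\<lambda>i. N i q) E)"
    proof (intro ext)
      fix F z
      have "facep (hlin (A <+> B) (\<lambda>i. N i q) E) F z
          = (\<Sum>(F', i)\<in>B. facep q F' (xf F' i) * (if F = F' then ef F' i z else 0))"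
        unfolding hlin_simps sum.Plus[OF fin]
        by (auto simp: E_def N_def case_prod_beta intro!: sum.cong)
      also have "\<dots> = (\<Sum>F'\<in>faces m. \<Sum>i<nf F'. facep q F' (xf F' i) * (if F = F' then ef F' i z else 0))"
        unfolding B_def by (rule sum.Sigma[symmetric]) (auto simp: finite_faces)
      also have "\<dots> = (\<Sum>F'\<in>faces m. if F = F' then \<Sum>i<nf F. facep q F (xf F i) * ef F i z else 0)"
        by (intro sum.cong) auto
      also have "\<dots> = facep q F z"
        using finite_faces exf[OF VhD(3)[OF q], of F z] VhD(4)[OF q, of F] by (auto simp: sum.delta)
      finally show "facep q F z = facep (hlin (A <+> B) (\<lambda>i. N i q) E) F z" ..
    qed
  qed
  with fin EV NN show ?thesis by (intro exI[of _ "A <+> B"] exI[of _ N] exI[of _ E]) auto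
qed

end

text \<open>Cells lie in the closure of \<Omega>; their interiors lie in \<Omega> itself because an
  open convex set is the interior of its closure.\<close>

lemma hho_meshI:
  assumes \<Omega>: "convex_polygonal_domain \<Omega>" and m: "polygonal_mesh \<Omega> m"
  shows "hho_mesh \<Omega> m"
proof
  show "is_cell K" if "K \<in> cells m" for K
    using m that by (auto simp: polygonal_mesh_def intro: polygonal_is_cell)
  show "is_face F" if "F \<in> faces m" for F
    using m that by (auto simp: polygonal_mesh_def is_face_def)
  show "\<Omega> \<in> sets lebesgue"
    using \<Omega> by (auto simp: convex_polygonal_domain_def intro: sets_completionI_sets)
  show "interior K \<subseteq> \<Omega>" if "K \<in> cells m" for K
  proof -
    have "K \<subseteq> closure \<Omega>" using m that by (auto simp: polygonal_mesh_def)
    then have "interior K \<subseteq> interior (closure \<Omega>)" by (rule interior_mono)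
    also have "\<dots> = \<Omega>"
      using \<Omega> by (simp add: convex_polygonal_domain_def convex_interior_closure interior_open)
    finally show ?thesis .
  qed
qed (use m in \<open>auto simp: polygonal_mesh_def\<close>)

section \<open>The energy argument\<close>

text \<open>The product rule yields two double sums, which the symmetry of \<open>G\<close>
  identifies; hence the factor 2.\<close>

lemma has_real_derivative_quadratic_form:
  assumes u: "\<And>i. i \<in> I \<Longrightarrow> (u i has_real_derivative du i) (at t)"
    and G: "\<And>i j. G i j = (G j i :: real)"
  shows "((\<lambda>t. \<Sum>i\<in>I. \<Sum>j\<in>I. u i t * u j t * G i j) has_real_derivative
    2 * (\<Sum>i\<in>I. \<Sum>j\<in>I. du i * u j t * G i j)) (at t)"
proof -
  have "((\<lambda>t. \<Sum>i\<in>I. \<Sum>j\<in>I. u i t * u j t * G i j) has_real_derivative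
    (\<Sum>i\<in>I. \<Sum>j\<in>I. (du i * u j t + du j * u i t) * G i j)) (at t)"
    by (intro DERIV_sum DERIV_cmult_right DERIV_mult u)
  moreover have "(\<Sum>i\<in>I. \<Sum>j\<in>I. du j * u i t * G i j) = (\<Sum>i\<in>I. \<Sum>j\<in>I. du i * u j t * G i j)"
    by (subst sum.swap) (simp add: G)
  ultimately show ?thesis by (simp add: distrib_right sum.distrib)
qed

text \<open>Truncation of negative numbers to 0 is subadditive. No sign is required because
  \<open>energy_estimate\<close> knows none for its energy.\<close>

lemma ennreal_plus_le: "ennreal (a + b) \<le> ennreal a + ennreal b"
proof -
  have "ennreal (a + b) \<le> ennreal (max 0 a + max 0 b)" by (intro ennreal_leI) auto
  also have "\<dots> = ennreal a + ennreal b" by (subst ennreal_plus) (auto simp: max_def ennreal_neg)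
  finally show ?thesis .
qed

text \<open>The expansion of a solution in coordinates is established for positive times only, so
  integrands agree on a half-open interval. The missing point is a null set, and measurability of
  \<open>h\<close> is deduced from that of \<open>h'\<close>.\<close>

lemma set_integral_spike_left:
  fixes h h' :: "real \<Rightarrow> real"
  assumes h': "set_integrable lborel {0..t} h'" and eq: "\<And>s. s \<in> {0<..t} \<Longrightarrow> h s = h' s"
  shows "(LINT s:{0..t}|lborel. h s) = (LINT s:{0..t}|lborel. h' s)"
proof -
  have m: "(\<lambda>s. indicat_real {0..t} s *\<^sub>R h' s) \<in> borel_measurable lborel"
    using h' unfolding set_integrable_def by (rule borel_measurable_integrable)
  have "(\<lambda>s. indicat_real {0..t} s *\<^sub>R h s)
      = (\<lambda>s. if s = 0 then indicat_real {0..t} 0 *\<^sub>R h 0 else indicat_real {0..t} s *\<^sub>R h' s)"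
    using eq by (auto simp: indicator_def fun_eq_iff)
  moreover have "\<dots> \<in> borel_measurable lborel" using m by measurable
  ultimately have "(\<lambda>s. indicat_real {0..t} s *\<^sub>R h s) \<in> borel_measurable lborel" by (simp only:)
  moreover have "AE s in lborel. indicat_real {0..t} s *\<^sub>R h s = indicat_real {0..t} s *\<^sub>R h' s"
    using AE_lborel_singleton[of "0::real"]
    by (rule AE_mp) (use eq in \<open>auto simp: indicator_def\<close>)
  ultimately show ?thesis unfolding set_lebesgue_integral_def using m by (intro integral_cong_AE)
qed

lemma set_integral_lincomb:
  fixes p :: "'i \<Rightarrow> 'a \<Rightarrow> real"
  assumes "\<And>i. i \<in> I \<Longrightarrow> set_integrable M A (p i)"
  shows "set_integrable M A (\<lambda>s. \<Sum>i\<in>I. p i s * c i)"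
    "(LINT s:A|M. (\<Sum>i\<in>I. p i s * c i)) = (\<Sum>i\<in>I. (LINT s:A|M. p i s) * c i)"
proof -
  have *: "(\<lambda>s. indicat_real A s *\<^sub>R (\<Sum>i\<in>I. p i s * c i)) = (\<lambda>s. \<Sum>i\<in>I. (indicat_real A s *\<^sub>R p i s) * c i)"
    by (auto simp: sum_distrib_left mult.assoc)
  show "set_integrable M A (\<lambda>s. \<Sum>i\<in>I. p i s * c i)"
    using assms unfolding set_integrable_def * by (intro Bochner_Integration.integrable_sum) auto
  show "(LINT s:A|M. (\<Sum>i\<in>I. p i s * c i)) = (\<Sum>i\<in>I. (LINT s:A|M. p i s) * c i)"
    using assms unfolding set_lebesgue_integral_def set_integrable_def *
    by (subst Bochner_Integration.integral_sum) auto
qed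

text \<open>\<open>F\<close> need not be measurable: its integral is then a lower integral, and it still
  dominates that of the continuous function \<open>2 * \<phi> - N\<close>.\<close>

lemma energy_estimate:
  fixes p :: "'i \<Rightarrow> real \<Rightarrow> real" and E1 D N \<phi> F :: "real \<Rightarrow> real"
  assumes p_cont: "\<And>i. i \<in> I \<Longrightarrow> continuous_on {0<..<T} (p i)"
    and p_int: "\<And>i t. i \<in> I \<Longrightarrow> t \<in> {0<..<T} \<Longrightarrow> set_integrable lborel {0..t} (p i)"
    and G_sym: "\<And>i j. G i j = (G j i :: real)"
    and E1: "\<And>t. t \<in> {0<..<T} \<Longrightarrow> (E1 has_real_derivative 2 * D t) (at t)"
    and D: "continuous_on {0<..<T} D"
    and E1_0: "(E1 \<longlongrightarrow> e0) (at_right 0)"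
    and N: "\<And>t. t \<in> {0<..<T} \<Longrightarrow> N t = (\<Sum>i\<in>I. \<Sum>j\<in>I. p i t * p j t * G i j)"
    and N_nonneg: "\<And>t. N t \<ge> 0"
    and scheme: "\<And>t. t \<in> {0<..<T} \<Longrightarrow>
      D t + N t + (\<Sum>i\<in>I. \<Sum>j\<in>I. p i t * (LINT s:{0..t}|lborel. p j s) * G i j) = \<phi> t"
    and bound: "\<And>t. t \<in> {0<..<T} \<Longrightarrow> 2 * \<phi> t - N t \<le> C * F t"
    and C: "C > 0" and F: "\<And>t. F t \<ge> 0" and t: "t \<in> {0<..<T}"
  shows "ennreal (E1 t + (LINT s:{0..t}|lborel. N s)
      + (\<Sum>i\<in>I. \<Sum>j\<in>I. (LINT s:{0..t}|lborel. p i s) * (LINT s:{0..t}|lborel. p j s) * G i j))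
    \<le> ennreal e0 + ennreal C * (\<integral>\<^sup>+s\<in>{0..t}. ennreal (F s) \<partial>lborel)"
proof -
  define P where "P i t = (LINT s:{0..t}|lborel. p i s)" for i t
  define E where "E t = E1 t + (\<Sum>i\<in>I. \<Sum>j\<in>I. P i t * P j t * G i j)" for t
  have P_eq: "P i u = integral {0..u} (p i)" if "i \<in> I" "u \<in> {0<..<T}" for i u
    unfolding P_def by (rule set_borel_integral_eq_integral(2)[OF p_int[OF that]])
  have P_deriv: "(P i has_real_derivative p i u) (at u)" if i: "i \<in> I" and u: "u \<in> {0<..<T}" for i u
  proof -
    \<comment> \<open>A slightly longer interval makes \<open>u\<close> an interior point, so that
      the derivative within \<open>[0, T']\<close> is the full one.\<close>
    obtain T' where T': "u < T'" "T' < T" using dense[of u T] u by auto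
    have "p i integrable_on {0..T'}"
      using T' u by (intro set_borel_integral_eq_integral(1) p_int i) auto
    moreover have "continuous (at u within {0..T'} - {}) (p i)"
      using p_cont[OF i] u by (auto simp: continuous_on_eq_continuous_at intro: continuous_at_imp_continuous_at_within)
    ultimately have "((\<lambda>u. integral {0..u} (p i)) has_vector_derivative p i u) (at u within {0..T'} - {})"
      using u T' by (intro integral_has_vector_derivative_continuous_at) auto
    then have "((\<lambda>u. integral {0..u} (p i)) has_real_derivative p i u) (at u)"
      using u T' by (simp add: at_within_Icc_at has_real_derivative_iff_has_vector_derivative)
    then show ?thesis
      by (rule has_field_derivative_transform_within_open[of _ _ _ "{0<..<T}"]) (use u P_eq[OF i] in auto)
  qed
  have P_0: "(P i \<longlongrightarrow> 0) (at_right 0)" if i: "i \<in> I" for i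
  proof -
    have "p i integrable_on {0..t}" by (intro set_borel_integral_eq_integral(1) p_int i t)
    from indefinite_integral_continuous_1[OF this]
    have "\<forall>x\<in>{0..t}. ((\<lambda>u. integral {0..u} (p i)) \<longlongrightarrow> integral {0..x} (p i)) (at x within {0..t})"
      by (simp only: continuous_on_def)
    then have "((\<lambda>u. integral {0..u} (p i)) \<longlongrightarrow> integral {0..0} (p i)) (at 0 within {0..t})"
      by (rule bspec) (use t in auto)
    then have "((\<lambda>u. integral {0..u} (p i)) \<longlongrightarrow> 0) (at_right 0)"
      using t by (simp add: at_within_Icc_at_right)
    moreover have "eventually (\<lambda>u. integral {0..u} (p i) = P i u) (at_right 0)"
      using t P_eq[OF i] by (intro eventually_at_rightI[of 0 t]) auto
    ultimately show ?thesis by (rule Lim_transform_eventually)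
  qed
  have P_cont: "continuous_on {0<..<T} (P i)" if "i \<in> I" for i
    by (rule DERIV_continuous_on) (rule has_field_derivative_at_within[OF P_deriv[OF that]])
  have N_cont: "continuous_on {0<..<T} N"
    by (subst continuous_on_cong[OF refl N]) (auto intro!: continuous_intros p_cont)
  \<comment> \<open>Continuity of \<open>\<phi>\<close> is inherited through the scheme from the
    three terms on its left-hand side.\<close>
  have \<phi>_cont: "continuous_on {0<..<T} \<phi>"
    by (subst continuous_on_cong[OF refl scheme[symmetric]])
      (auto intro!: continuous_intros p_cont P_cont D N_cont simp: P_def[symmetric])
  \<comment> \<open>The memory term of the scheme is half the derivative of the second part of
    \<open>E\<close>. One of the two copies of \<open>N\<close> is kept with \<open>\<phi>\<close>,
    to absorb the forcing by \<open>bound\<close>.\<close>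
  have E_deriv: "(E has_real_derivative (2 * \<phi> u - N u) - N u) (at u)" if u: "u \<in> {0<..<T}" for u
  proof -
    have "(E has_real_derivative 2 * D u + 2 * (\<Sum>i\<in>I. \<Sum>j\<in>I. p i u * P j u * G i j)) (at u)"
      unfolding E_def[abs_def] by (intro DERIV_add E1 u has_real_derivative_quadratic_form P_deriv G_sym)
    moreover have "2 * D u + 2 * (\<Sum>i\<in>I. \<Sum>j\<in>I. p i u * P j u * G i j) = (2 * \<phi> u - N u) - N u"
      using scheme[OF u] unfolding P_def by simp
    ultimately show ?thesis by simp
  qed
  have E_0: "(E \<longlongrightarrow> e0) (at_right 0)"
  proof -
    have "(E \<longlongrightarrow> e0 + (\<Sum>i\<in>I. \<Sum>j\<in>I. 0 * 0 * G i j)) (at_right 0)"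
      unfolding E_def[abs_def] by (intro tendsto_intros E1_0 P_0)
    then show ?thesis by simp
  qed
  let ?R = "\<integral>\<^sup>+s\<in>{0..t}. ennreal (F s) \<partial>lborel"
  have step: "ennreal (E t + integral {\<epsilon>..t} N) \<le> ennreal (E \<epsilon>) + ennreal C * ?R"
    if \<epsilon>: "0 < \<epsilon>" "\<epsilon> < t" for \<epsilon>
  proof -
    have sub: "{\<epsilon>..t} \<subseteq> {0<..<T}" using \<epsilon> t by auto
    \<comment> \<open>A continuous nonnegative mediator: \<open>2 * \<phi> - N \<le> C * H\<close>,
      and \<open>H \<le> F\<close> on the interval. Integration is carried out with
      \<open>H\<close>, while \<open>F\<close> enters only through a pointwise comparison.\<close>
    define H where "H s = max 0 ((2 * \<phi> s - N s) / C)" for s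
    have N_c: "continuous_on {\<epsilon>..t} N" and H_c: "continuous_on {\<epsilon>..t} H"
      unfolding H_def using C
      by (intro continuous_intros continuous_on_subset[OF N_cont sub] continuous_on_subset[OF \<phi>_cont sub]; simp)+
    have "((\<lambda>s. (2 * \<phi> s - N s) - N s) has_integral (E t - E \<epsilon>)) {\<epsilon>..t}"
    proof (rule fundamental_theorem_of_calculus)
      fix s assume "s \<in> {\<epsilon>..t}"
      then have "s \<in> {0<..<T}" using sub by blast
      then have "(E has_real_derivative (2 * \<phi> s - N s) - N s) (at s within {\<epsilon>..t})"
        by (rule has_field_derivative_at_within[OF E_deriv])
      then show "(E has_vector_derivative (2 * \<phi> s - N s) - N s) (at s within {\<epsilon>..t})"
        by (simp only: has_real_derivative_iff_has_vector_derivative)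
    qed (use \<epsilon> in auto)
    moreover have "(N has_integral integral {\<epsilon>..t} N) {\<epsilon>..t}"
      by (intro integrable_integral integrable_continuous_real N_c)
    ultimately have int: "((\<lambda>s. ((2 * \<phi> s - N s) - N s) + N s) has_integral
        (E t - E \<epsilon>) + integral {\<epsilon>..t} N) {\<epsilon>..t}"
      by (rule has_integral_add)
    have H_int: "((\<lambda>s. C * H s) has_integral C * integral {\<epsilon>..t} H) {\<epsilon>..t}"
      by (intro has_integral_mult_right integrable_integral integrable_continuous_real H_c)
    have "(2 * \<phi> s - N s) - N s + N s \<le> C * H s" for s
    proof -
      have "2 * \<phi> s - N s = C * ((2 * \<phi> s - N s) / C)" using C by simp
      also have "\<dots> \<le> C * H s" unfolding H_def using C by (intro mult_left_mono) auto
      finally show ?thesis by simp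
    qed
    from has_integral_le[OF int H_int this]
    have le: "E t + integral {\<epsilon>..t} N \<le> E \<epsilon> + C * integral {\<epsilon>..t} H" by linarith
    have H_si: "set_integrable lborel {\<epsilon>..t} H" by (rule borel_integrable_atLeastAtMost'[OF H_c])
    have "ennreal (integral {\<epsilon>..t} H) = ennreal (LINT s|lborel. indicat_real {\<epsilon>..t} s *\<^sub>R H s)"
      using set_borel_integral_eq_integral(2)[OF H_si] by (simp add: set_lebesgue_integral_def)
    also have "\<dots> = (\<integral>\<^sup>+s. ennreal (indicat_real {\<epsilon>..t} s *\<^sub>R H s) \<partial>lborel)"
      using H_si unfolding set_integrable_def
      by (intro nn_integral_eq_integral[symmetric]) (auto simp: H_def)
    also have "\<dots> \<le> ?R"
    proof (rule nn_integral_mono)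
      fix s
      show "ennreal (indicat_real {\<epsilon>..t} s *\<^sub>R H s) \<le> ennreal (F s) * indicator {0..t} s"
      proof (cases "s \<in> {\<epsilon>..t}")
        case True
        then have "(2 * \<phi> s - N s) / C \<le> F s"
          using bound[of s] sub C by (auto simp: field_simps)
        then have "H s \<le> F s" using F by (simp add: H_def)
        with True \<epsilon> show ?thesis by (auto intro: ennreal_leI)
      qed simp
    qed
    finally have HR: "ennreal (integral {\<epsilon>..t} H) \<le> ?R" .
    have "ennreal (E t + integral {\<epsilon>..t} N) \<le> ennreal (E \<epsilon>) + ennreal (C * integral {\<epsilon>..t} H)"
      using le by (intro order_trans[OF ennreal_leI ennreal_plus_le])
    also have "ennreal (C * integral {\<epsilon>..t} H) = ennreal C * ennreal (integral {\<epsilon>..t} H)"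
      using C by (intro ennreal_mult) (auto intro!: integral_nonneg integrable_continuous_real H_c simp: H_def)
    finally show ?thesis
      using HR by (meson add_left_mono mult_left_mono order_trans zero_le)
  qed
  \<comment> \<open>The integral over \<open>[\<epsilon>, t]\<close> is replaced by a lower bound
    \<open>Y\<close> that has a limit, so the passage to the limit also works if \<open>N\<close> is
    not integrable up to 0.\<close>
  have fin: "ennreal (E t + y) \<le> ennreal e0 + ennreal C * ?R"
    if y: "(Y \<longlongrightarrow> y) (at_right 0)" and le: "\<And>\<epsilon>. 0 < \<epsilon> \<Longrightarrow> \<epsilon> < t \<Longrightarrow> Y \<epsilon> \<le> integral {\<epsilon>..t} N" for Y y
  proof (rule tendsto_le)
    show "((\<lambda>\<epsilon>. ennreal (E \<epsilon>) + ennreal C * ?R) \<longlongrightarrow> ennreal e0 + ennreal C * ?R) (at_right 0)"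
      by (intro tendsto_add tendsto_ennrealI tendsto_const E_0)
    show "((\<lambda>\<epsilon>. ennreal (E t + Y \<epsilon>)) \<longlongrightarrow> ennreal (E t + y)) (at_right 0)"
      by (intro tendsto_add tendsto_ennrealI tendsto_const y)
    show "eventually (\<lambda>\<epsilon>. ennreal (E t + Y \<epsilon>) \<le> ennreal (E \<epsilon>) + ennreal C * ?R) (at_right 0)"
    proof (rule eventually_at_rightI)
      fix \<epsilon> assume "\<epsilon> \<in> {0<..<t}"
      then have \<epsilon>: "0 < \<epsilon>" "\<epsilon> < t" by auto
      have "ennreal (E t + Y \<epsilon>) \<le> ennreal (E t + integral {\<epsilon>..t} N)"
        using le[OF \<epsilon>] by (intro ennreal_leI) simp
      also note step[OF \<epsilon>]
      finally show "ennreal (E t + Y \<epsilon>) \<le> ennreal (E \<epsilon>) + ennreal C * ?R" .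
    qed (use t in auto)
  qed simp
  have "ennreal (E t + (LINT s:{0..t}|lborel. N s)) \<le> ennreal e0 + ennreal C * ?R"
  \<comment> \<open>If \<open>N\<close> is not integrable up to 0, its Bochner integral is 0 by
    default and nonnegativity of the integrals over \<open>[\<epsilon>, t]\<close> suffices. Nothing
    is lost: when the right-hand side is finite, \<open>step\<close> bounds these integrals
    uniformly, so that this case occurs only for an infinite right-hand side.\<close>
  proof (cases "set_integrable lborel {0..t} N")
    case True
    note N_i = set_borel_integral_eq_integral[OF True]
    have "\<forall>x\<in>{0..t}. ((\<lambda>u. integral {0..u} N) \<longlongrightarrow> integral {0..x} N) (at x within {0..t})"
      using indefinite_integral_continuous_1[OF N_i(1)] by (simp only: continuous_on_def)
    then have "((\<lambda>u. integral {0..u} N) \<longlongrightarrow> integral {0..0} N) (at 0 within {0..t})"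
      by (rule bspec) (use t in auto)
    then have lim: "((\<lambda>u. integral {0..u} N) \<longlongrightarrow> 0) (at_right 0)"
      using t by (simp add: at_within_Icc_at_right)
    have "((\<lambda>\<epsilon>. integral {0..t} N - integral {0..\<epsilon>} N) \<longlongrightarrow> integral {0..t} N - 0) (at_right 0)"
      by (intro tendsto_intros lim)
    moreover have "integral {0..t} N - integral {0..\<epsilon>} N \<le> integral {\<epsilon>..t} N" if "0 < \<epsilon>" "\<epsilon> < t" for \<epsilon>
      using Henstock_Kurzweil_Integration.integral_combine[of 0 \<epsilon> t N] that N_i(1) by simp
    ultimately show ?thesis unfolding N_i(2) by (intro fin) auto
  next
    case False
    then have "(LINT s:{0..t}|lborel. N s) = 0"
      unfolding set_integrable_def set_lebesgue_integral_def by (rule not_integrable_integral_eq)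
    moreover have "0 \<le> integral {\<epsilon>..t} N" if "0 < \<epsilon>" "\<epsilon> < t" for \<epsilon>
      using that t N_nonneg
      by (intro integral_nonneg integrable_continuous_real continuous_on_subset[OF N_cont]) auto
    ultimately show ?thesis using fin[of "\<lambda>_. 0" 0] by simp
  qed
  then show ?thesis by (simp add: E_def P_def ac_simps)
qed

section \<open>The mass form in nodal coordinates\<close>

context hho_mesh begin

definition mass :: "(plane set \<Rightarrow> plane \<Rightarrow> real) \<Rightarrow> (plane set \<Rightarrow> plane \<Rightarrow> real) \<Rightarrow> real" where
  "mass u v = (\<Sum>K\<in>cells m. l2_inner (lebesgue_on K) (u K) (v K))"

text \<open>The cell part gets coordinates of its own because \<open>cell_dt\<close> is a family of
  cell polynomials without face components. The Gram matrix depends on the cell, the nodes do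
  not.\<close>

lemma mass_nodal:
  "\<exists>n x G. (\<forall>K a b. G K a b = (G K b a :: real)) \<and>
    (\<forall>u v. (\<forall>K\<in>cells m. u K \<in> polys k) \<longrightarrow> (\<forall>K\<in>cells m. v K \<in> polys k) \<longrightarrow>
      mass u v = (\<Sum>K\<in>cells m. \<Sum>a<(n::nat). \<Sum>b<n. u K (x a) * v K (x b) * G K a b))"
proof -
  obtain n x e where e: "\<And>i. i < (n::nat) \<Longrightarrow> e i \<in> polys k"
    and ex: "\<And>w z. w \<in> polys k \<Longrightarrow> w z = (\<Sum>i<n. w (x i) * e i z)"
    using nodal_basis[OF finite_poly_index, of k "\<lambda>(i, j) x::plane. x $ 1 ^ i * x $ 2 ^ j"]
    unfolding polys_spanned[symmetric] by blast
  define G where "G K a b = l2_inner (lebesgue_on K) (e a) (e b)" for K a b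
  have "l2_inner (lebesgue_on K) u v = (\<Sum>a<n. \<Sum>b<n. u (x a) * v (x b) * G K a b)"
    if K: "K \<in> cells m" and u: "u \<in> polys k" and v: "v \<in> polys k" for K u v
  proof -
    have L: "w \<in> L2 (lebesgue_on K)" if "w \<in> polys k" for w
      using that polys_L2_cell[OF cell[OF K]] by blast
    have eL: "e a \<in> L2 (lebesgue_on K)" if "a \<in> {..<n}" for a using that e L by blast
    have "u = (\<lambda>z. \<Sum>a<n. u (x a) * e a z)" by (rule ext) (rule ex[OF u])
    then have "l2_inner (lebesgue_on K) u v = l2_inner (lebesgue_on K) (\<lambda>z. \<Sum>a<n. u (x a) * e a z) v"
      by (rule arg_cong)
    also have "\<dots> = (\<Sum>a<n. u (x a) * l2_inner (lebesgue_on K) (e a) v)"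
      by (rule flinear_sum[OF fsubspace_L2 flinear_l2_inner[OF L[OF v]] eL])
    also have "\<dots> = (\<Sum>a<n. u (x a) * (\<Sum>b<n. v (x b) * G K a b))"
    proof (intro sum.cong refl arg_cong[of _ _ "(*) _"])
      fix a assume a: "a \<in> {..<n}"
      have "v = (\<lambda>z. \<Sum>b<n. v (x b) * e b z)" by (rule ext) (rule ex[OF v])
      then have "l2_inner (lebesgue_on K) (e a) v
          = l2_inner (lebesgue_on K) (e a) (\<lambda>z. \<Sum>b<n. v (x b) * e b z)"
        by (rule arg_cong)
      also have "\<dots> = (\<Sum>b<n. v (x b) * G K a b)"
        unfolding G_def by (rule flinear_sum[OF fsubspace_L2 flinear_l2_inner'[OF eL[OF a]] eL])
      finally show "l2_inner (lebesgue_on K) (e a) v = (\<Sum>b<n. v (x b) * G K a b)" .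
    qed
    finally show ?thesis by (simp add: sum_distrib_left mult.assoc)
  qed
  then have "mass u v = (\<Sum>K\<in>cells m. \<Sum>a<n. \<Sum>b<n. u K (x a) * v K (x b) * G K a b)"
    if "\<forall>K\<in>cells m. u K \<in> polys k" "\<forall>K\<in>cells m. v K \<in> polys k" for u v
    unfolding mass_def using that by (intro sum.cong) auto
  moreover have "G K a b = G K b a" for K a b by (simp add: G_def l2_inner_commute)
  ultimately show ?thesis by (intro exI[of _ n] exI[of _ x] exI[of _ G]) simp
qed

lemma l2_inner_broken_mass:
  assumes "\<And>K. K \<in> cells m \<Longrightarrow> u K \<in> polys k" "\<And>K. K \<in> cells m \<Longrightarrow> v K \<in> polys k"
  shows "l2_inner (lebesgue_on \<Omega>) (broken m u) (broken m v) = mass u v"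
  unfolding mass_def by (rule l2_inner_broken_broken[of u k v k]) (use assms in auto)

end

lemma C1_differentiable_deriv:
  fixes h :: "real \<Rightarrow> real"
  assumes "h C1_differentiable_on S"
  shows "\<And>t. t \<in> S \<Longrightarrow> (h has_real_derivative deriv h t) (at t)" "continuous_on S (deriv h)"
    "continuous_on S h"
proof -
  from assms obtain D where D: "\<And>t. t \<in> S \<Longrightarrow> (h has_vector_derivative D t) (at t)" "continuous_on S D"
    by (auto simp: C1_differentiable_on_def)
  have D': "(h has_real_derivative D t) (at t)" if "t \<in> S" for t
    using D(1)[OF that] by (simp add: has_real_derivative_iff_has_vector_derivative)
  then have eq: "deriv h t = D t" if "t \<in> S" for t using that by (intro DERIV_imp_deriv) auto
  show "(h has_real_derivative deriv h t) (at t)" if "t \<in> S" for t using D' eq that by simp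
  show "continuous_on S (deriv h)" using D(2) eq by (subst continuous_on_cong[OF refl eq]) auto
  show "continuous_on S h"
    by (rule DERIV_continuous_on) (rule has_field_derivative_at_within[OF D'])
qed

text \<open>Both sides are in \<open>ennreal\<close> to admit an infinite forcing integral; the real
  number on the left is a sum of nonnegative terms, so the embedding loses nothing.\<close>

theorem lemma3p1:
  fixes \<Omega> :: "plane set" and T \<rho> Ceqv Cdp :: real and k :: nat
    and \<M> :: "mesh set" and m :: mesh
    and g :: "plane \<Rightarrow> real" and f :: "real \<Rightarrow> plane \<Rightarrow> real" and p :: "real \<Rightarrow> hybrid"
  assumes domain: "convex_polygonal_domain \<Omega>" and T: "T > 0"
    and g: "g \<in> H1 \<Omega>"
    and f: "\<And>t. t \<in> {0<..<T} \<Longrightarrow> f t \<in> L2 (lebesgue_on \<Omega>)"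
    and rho: "0 < \<rho>" "\<rho> < 1"
    and regular_family: "\<And>m'. m' \<in> \<M> \<Longrightarrow> polygonal_mesh \<Omega> m' \<and> regular_mesh \<rho> m'"
    and Ceqv: "Ceqv > 0"
      "\<And>m' q. m' \<in> \<M> \<Longrightarrow> q \<in> Vh0 \<Omega> m' k \<Longrightarrow>
         Ceqv * norm_HHO m' q \<le> norm_1h m' k q \<and> norm_1h m' k q \<le> inverse Ceqv * norm_HHO m' q"
    and Cdp: "Cdp > 0"
      "\<And>m' q. m' \<in> \<M> \<Longrightarrow> q \<in> Vh0 \<Omega> m' k \<Longrightarrow>
         l2_norm (lebesgue_on \<Omega>) (broken m' (cellp q)) \<le> Cdp * norm_HHO m' q"
    and m: "m \<in> \<M>"
    and p_space: "\<And>t. t \<in> {0<..<T} \<Longrightarrow> p t \<in> Vh0 \<Omega> m k"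
    and p_C1: "hybrid_C1 m {0<..<T} p"
    and p_integrable: "\<And>t. t \<in> {0<..<T} \<Longrightarrow> hybrid_integrable m {0..t} p"
    and scheme: "\<And>t q. t \<in> {0<..<T} \<Longrightarrow> q \<in> Vh0 \<Omega> m k \<Longrightarrow>
        l2_inner (lebesgue_on \<Omega>) (broken m (cell_dt p t)) (broken m (cellp q))
        + bh m k (p t) q + (LINT s:{0..t}|lborel. bh m k (p s) q)
        = l2_inner (lebesgue_on \<Omega>) (f t) (broken m (cellp q))"
    and init: "initial_value m p (hho_interp \<Omega> m k g)"
  shows "\<And>t. t \<in> {0<..<T} \<Longrightarrow>
    ennreal ((l2_norm (lebesgue_on \<Omega>) (broken m (cellp (p t))))\<^sup>2
             + (LINT s:{0..t}|lborel. (norm_1h m k (p s))\<^sup>2)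
             + (norm_1h m k (hybrid_integral {0..t} p))\<^sup>2)
    \<le> ennreal ((l2_norm (lebesgue_on \<Omega>) g)\<^sup>2)
      + ennreal (Cdp\<^sup>2 / Ceqv\<^sup>2) * (\<integral>\<^sup>+s\<in>{0..t}. ennreal ((l2_norm (lebesgue_on \<Omega>) (f s))\<^sup>2) \<partial>lborel)"
proof -
  fix t assume t: "t \<in> {0<..<T}"
  have mesh: "polygonal_mesh \<Omega> m" using regular_family[OF m] by simp
  interpret hho_mesh \<Omega> m by (rule hho_meshI[OF domain mesh])
  let ?J = "{0<..<T}"
  have pV: "p s \<in> Vh m k" if "s \<in> ?J" for s using p_space[OF that] by (simp add: Vh0_def)
  obtain I :: "(plane set \<times> nat + plane set \<times> nat) set" and N E where
    nodal: "finite I" "\<forall>i\<in>I. E i \<in> Vh m k"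
      "\<forall>i\<in>I. (\<exists>K\<in>cells m. \<exists>x. N i = (\<lambda>q. cellp q K x)) \<or> (\<exists>F\<in>faces m. \<exists>x. N i = (\<lambda>q. facep q F x))"
      "\<forall>q\<in>Vh m k. q = hlin I (\<lambda>i. N i q) E"
    using Vh_nodal[of k] by (elim exE conjE)
  note E = nodal(2)[rule_format] and N = nodal(3)[rule_format] and NE = nodal(4)[rule_format]
  obtain n x G where
    mass_ex: "\<forall>K a b. G K a b = (G K b a :: real)"
      "\<forall>u v. (\<forall>K\<in>cells m. u K \<in> polys k) \<longrightarrow> (\<forall>K\<in>cells m. v K \<in> polys k) \<longrightarrow>
        mass u v = (\<Sum>K\<in>cells m. \<Sum>a<(n::nat). \<Sum>b<n. u K (x a) * v K (x b) * G K a b)"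
    using mass_nodal[of k] by (elim exE conjE)
  note G = mass_ex(1)[rule_format] and mass = mass_ex(2)[rule_format]
  \<comment> \<open>\<open>P i s\<close> will be the coordinates of the integral of \<open>p\<close>
    over \<open>[0, s]\<close>, and \<open>B\<close> is the Gram matrix of
    \<open>bh\<close>.\<close>
  define P where "P i s = (LINT r:{0..s}|lborel. N i (p r))" for i s
  define B where "B i j = bh m k (E i) (E j)" for i j
  have N_cont: "continuous_on ?J (\<lambda>s. N i (p s))" if "i \<in> I" for i
    using N[OF that] p_C1 C1_differentiable_deriv(3) by (auto simp: hybrid_C1_def)
  have N_int: "set_integrable lborel {0..s} (\<lambda>r. N i (p r))" if "i \<in> I" "s \<in> ?J" for i s
    using N[OF that(1)] p_integrable[OF that(2)] by (auto simp: hybrid_integrable_def)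
  have p_eq: "p s = hlin I (\<lambda>i. N i (p s)) E" if "s \<in> ?J" for s by (rule NE[OF pV[OF that]])
  have bh_eq: "bh m k (hlin I c E) (hlin I d E) = (\<Sum>i\<in>I. \<Sum>j\<in>I. c i * d j * B i j)" for c d
    unfolding B_def by (rule bh_hlin2[OF E])
  have norm_eq: "(norm_1h m k (p s))\<^sup>2 = (\<Sum>i\<in>I. \<Sum>j\<in>I. N i (p s) * N j (p s) * B i j)" if "s \<in> ?J" for s
    unfolding norm_1h_sq bh_eq[symmetric] p_eq[OF that, symmetric] ..
  \<comment> \<open>Meant for quantities linear in \<open>p r\<close>: the coefficients
    \<open>c i\<close> do not depend on \<open>r\<close>, so the integral reduces to those of the
    coordinates. The value at \<open>r = 0\<close> is left open.\<close>
  have integral_nodal: "(LINT r:{0..s}|lborel. h r) = (\<Sum>i\<in>I. P i s * c i)"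
    if s: "s \<in> ?J" and h: "\<And>r. r \<in> {0<..s} \<Longrightarrow> h r = (\<Sum>i\<in>I. N i (p r) * c i)" for h c s
  proof -
    have i: "set_integrable lborel {0..s} (\<lambda>r. \<Sum>i\<in>I. N i (p r) * c i)"
      by (rule set_integral_lincomb(1)) (rule N_int[OF _ s])
    have "(LINT r:{0..s}|lborel. h r) = (LINT r:{0..s}|lborel. (\<Sum>i\<in>I. N i (p r) * c i))"
      by (rule set_integral_spike_left[OF i h])
    also have "\<dots> = (\<Sum>i\<in>I. P i s * c i)"
      unfolding P_def by (rule set_integral_lincomb(2)) (rule N_int[OF _ s])
    finally show ?thesis .
  qed
  have int_eq: "hybrid_integral {0..s} p = hlin I (\<lambda>i. P i s) E" if s: "s \<in> ?J" for s
  proof -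
    have comp: "cellp (p r) = cellp (hlin I (\<lambda>i. N i (p r)) E)" "facep (p r) = facep (hlin I (\<lambda>i. N i (p r)) E)"
      if "r \<in> {0<..s}" for r
      using p_eq[of r] that s by auto
    have "(LINT r:{0..s}|lborel. cellp (p r) K z) = (\<Sum>i\<in>I. P i s * cellp (E i) K z)" for K z
      by (rule integral_nodal[OF s]) (simp add: comp hlin_simps)
    moreover have "(LINT r:{0..s}|lborel. facep (p r) F z) = (\<Sum>i\<in>I. P i s * facep (E i) F z)" for F z
      by (rule integral_nodal[OF s]) (simp add: comp hlin_simps)
    ultimately show ?thesis by (simp add: hybrid_integral_def hlin_def)
  qed
  \<comment> \<open>The test function \<open>p s\<close> is frozen while \<open>r\<close> varies, so
    the integrand is linear in \<open>p r\<close>.\<close>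
  have memory: "(LINT r:{0..s}|lborel. bh m k (p r) (p s)) = (\<Sum>i\<in>I. \<Sum>j\<in>I. N i (p s) * P j s * B i j)"
    if s: "s \<in> ?J" for s
  proof -
    have "(LINT r:{0..s}|lborel. bh m k (p r) (p s)) = (\<Sum>i\<in>I. P i s * bh m k (E i) (p s))"
    proof (rule integral_nodal[OF s])
      fix r assume "r \<in> {0<..s}"
      then have "r \<in> ?J" using s by auto
      from p_eq[OF this] bh_hlin[OF E pV[OF s], of I "\<lambda>i. i" "\<lambda>i. N i (p r)"]
      show "bh m k (p r) (p s) = (\<Sum>i\<in>I. N i (p r) * bh m k (E i) (p s))" by simp
    qed
    also have "\<dots> = bh m k (hlin I (\<lambda>i. P i s) E) (p s)"
      using bh_hlin[OF E pV[OF s], of I "\<lambda>i. i"] by simp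
    also have "\<dots> = bh m k (hlin I (\<lambda>i. N i (p s)) E) (hlin I (\<lambda>i. P i s) E)"
      unfolding p_eq[OF s, symmetric] by (rule bh_commute)
    finally show ?thesis unfolding bh_eq .
  qed
  have cellp_polys: "cellp (p s) K \<in> polys k" if "s \<in> ?J" "K \<in> cells m" for s K
    using VhD(1)[OF pV[OF that(1)] that(2)] .
  have C1: "(\<lambda>s. cellp (p s) K z) C1_differentiable_on ?J" if "K \<in> cells m" for K z
    using p_C1 that by (auto simp: hybrid_C1_def)
  have dt: "((\<lambda>s. cellp (p s) K z) has_real_derivative cell_dt p s K z) (at s)"
    if "s \<in> ?J" "K \<in> cells m" for s K z
    unfolding cell_dt_def by (rule C1_differentiable_deriv(1)[OF C1[OF that(2)] that(1)])
  have dt_cont: "continuous_on ?J (\<lambda>s. cell_dt p s K z)" if "K \<in> cells m" for K z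
    using C1_differentiable_deriv(2)[OF C1[OF that]] by (simp add: cell_dt_def[abs_def])
  have cell_cont: "continuous_on ?J (\<lambda>s. cellp (p s) K z)" if "K \<in> cells m" for K z
    by (rule C1_differentiable_deriv(3)[OF C1[OF that]])
  \<comment> \<open>The nodal functions are fixed in time, so differentiating the expansion shows
    that the pointwise derivative is again a polynomial.\<close>
  have dt_polys: "cell_dt p s K \<in> polys k" if s: "s \<in> ?J" and K: "K \<in> cells m" for s K
  proof -
    obtain n' x' e where e: "\<And>i. i < (n'::nat) \<Longrightarrow> e i \<in> polys k"
      and ex: "\<And>w z. w \<in> polys k \<Longrightarrow> w z = (\<Sum>i<n'. w (x' i) * e i z)"
      using nodal_basis[OF finite_poly_index, of k "\<lambda>(i, j) x::plane. x $ 1 ^ i * x $ 2 ^ j"]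
      unfolding polys_spanned[symmetric] by blast
    have "cell_dt p s K z = (\<Sum>i<n'. cell_dt p s K (x' i) * e i z)" for z
    proof -
      have "((\<lambda>s. \<Sum>i<n'. cellp (p s) K (x' i) * e i z) has_real_derivative
          (\<Sum>i<n'. cell_dt p s K (x' i) * e i z)) (at s)"
        by (intro DERIV_sum DERIV_cmult_right dt s K)
      then have "((\<lambda>s. cellp (p s) K z) has_real_derivative (\<Sum>i<n'. cell_dt p s K (x' i) * e i z)) (at s)"
        by (rule has_field_derivative_transform_within_open[of _ _ _ ?J])
          (use s ex[OF cellp_polys[OF _ K]] in auto)
      then show ?thesis unfolding cell_dt_def by (rule DERIV_imp_deriv)
    qed
    then have "cell_dt p s K = (\<lambda>z. \<Sum>i<n'. cell_dt p s K (x' i) * e i z)" by (rule ext)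
    also have "\<dots> \<in> polys k" by (intro fsubspace_sum[OF fsubspace_polys] e) auto
    finally show ?thesis .
  qed
  \<comment> \<open>Written in node values so that the product rule applies; \<open>D\<close> is
    half the derivative of \<open>E1\<close>.\<close>
  define E1 where "E1 s = (\<Sum>K\<in>cells m. \<Sum>a<n. \<Sum>b<n. cellp (p s) K (x a) * cellp (p s) K (x b) * G K a b)" for s
  define D where "D s = (\<Sum>K\<in>cells m. \<Sum>a<n. \<Sum>b<n. cell_dt p s K (x a) * cellp (p s) K (x b) * G K a b)" for s
  have E1_norm: "(l2_norm (lebesgue_on \<Omega>) (broken m (cellp (p s))))\<^sup>2 = E1 s" if s: "s \<in> ?J" for s
    unfolding l2_norm_sq E1_def
    using l2_inner_broken_mass[of "cellp (p s)" k "cellp (p s)"] mass[of "cellp (p s)" "cellp (p s)"]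
      cellp_polys[OF s] by simp
  have D_inner: "l2_inner (lebesgue_on \<Omega>) (broken m (cell_dt p s)) (broken m (cellp (p s))) = D s"
    if s: "s \<in> ?J" for s
    unfolding D_def
    using l2_inner_broken_mass[of "cell_dt p s" k "cellp (p s)"] mass[of "cell_dt p s" "cellp (p s)"]
      cellp_polys[OF s] dt_polys[OF s] by simp
  let ?q0 = "hho_interp \<Omega> m k g"
  \<comment> \<open>The limit of \<open>E1\<close> at 0, obtained from the convergence of the point
    values of the cell part. It is the squared norm of the projection of \<open>g\<close>.\<close>
  define e0 where "e0 = (\<Sum>K\<in>cells m. \<Sum>a<n. \<Sum>b<n. cellp ?q0 K (x a) * cellp ?q0 K (x b) * G K a b)"
  have gL: "g \<in> L2 (lebesgue_on \<Omega>)" using g by (simp add: H1_def)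
  have q0: "cellp ?q0 K = proj_cell k K g" if "K \<in> cells m" for K
    using that by (simp add: hho_interp_def)
  have q0_polys: "cellp ?q0 K \<in> polys k" if "K \<in> cells m" for K
    unfolding q0[OF that] by (rule proj_cell(1)[OF domain_cell_L2[OF that gL] that])
  have e0_le: "e0 \<le> (l2_norm (lebesgue_on \<Omega>) g)\<^sup>2"
  proof -
    have "e0 = mass (cellp ?q0) (cellp ?q0)"
      unfolding e0_def by (rule mass[symmetric]) (rule q0_polys, assumption)+
    also have "\<dots> = (\<Sum>K\<in>cells m. l2_inner (lebesgue_on K) (proj_cell k K g) (proj_cell k K g))"
      unfolding mass_def by (simp add: q0)
    also have "\<dots> \<le> (l2_norm (lebesgue_on \<Omega>) g)\<^sup>2" by (rule proj_cell_norm_le[OF gL])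
    finally show ?thesis .
  qed
  let ?C = "Cdp\<^sup>2 / Ceqv\<^sup>2"
  have C: "?C > 0" using Ceqv(1) Cdp(1) by simp
  let ?\<phi> = "\<lambda>s. l2_inner (lebesgue_on \<Omega>) (f s) (broken m (cellp (p s)))"
  \<comment> \<open>Poincare and norm equivalence bound the squared norm of the cell part by
    \<open>?C\<close> times that of \<open>p s\<close> in \<open>norm_1h\<close>. Young's inequality
    with weight \<open>?C\<close> therefore costs exactly one copy of the latter.\<close>
  have bound: "2 * ?\<phi> s - (norm_1h m k (p s))\<^sup>2 \<le> ?C * (l2_norm (lebesgue_on \<Omega>) (f s))\<^sup>2" if s: "s \<in> ?J" for s
  proof -
    let ?u = "broken m (cellp (p s))"
    have u: "?u \<in> L2 (lebesgue_on \<Omega>)" by (rule broken_L2[where k = k]) (rule cellp_polys[OF s])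
    have "l2_norm (lebesgue_on \<Omega>) ?u \<le> Cdp * norm_HHO m (p s)" by (rule Cdp(2)[OF m p_space[OF s]])
    also have "\<dots> \<le> Cdp * (norm_1h m k (p s) / Ceqv)"
      using Ceqv(2)[OF m p_space[OF s]] Ceqv(1) Cdp(1) by (intro mult_left_mono) (auto simp: field_simps)
    finally have "(l2_norm (lebesgue_on \<Omega>) ?u)\<^sup>2 \<le> (Cdp * (norm_1h m k (p s) / Ceqv))\<^sup>2"
      by (rule power_mono) (simp add: l2_norm_def l2_inner_nonneg)
    also have "\<dots> = ?C * (norm_1h m k (p s))\<^sup>2" by (simp add: power_mult_distrib power_divide)
    finally have "(l2_norm (lebesgue_on \<Omega>) ?u)\<^sup>2 / ?C \<le> (norm_1h m k (p s))\<^sup>2"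
      using C by (simp only: pos_divide_le_eq mult.commute)
    with l2_inner_young[OF f[OF s] u C] show ?thesis by linarith
  qed
  have "ennreal (E1 t + (LINT s:{0..t}|lborel. (norm_1h m k (p s))\<^sup>2)
      + (\<Sum>i\<in>I. \<Sum>j\<in>I. (LINT s:{0..t}|lborel. N i (p s)) * (LINT s:{0..t}|lborel. N j (p s)) * B i j))
    \<le> ennreal e0 + ennreal ?C * (\<integral>\<^sup>+s\<in>{0..t}. ennreal ((l2_norm (lebesgue_on \<Omega>) (f s))\<^sup>2) \<partial>lborel)"
  proof (rule energy_estimate[where p = "\<lambda>i s. N i (p s)" and \<phi> = ?\<phi> and D = D and T = T])
    show "B i j = B j i" for i j unfolding B_def by (rule bh_commute)
    show "(E1 has_real_derivative 2 * D s) (at s)" if s: "s \<in> ?J" for s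
      \<comment> \<open>The factor 2 is moved inside the sum over cells only, so that each cell has
        the shape of the derivative of a quadratic form.\<close>
      unfolding E1_def[abs_def] D_def sum_distrib_left[of 2 _ "cells m"]
      by (intro DERIV_sum has_real_derivative_quadratic_form dt s G)
    show "continuous_on ?J D"
      unfolding D_def[abs_def] by (intro continuous_intros dt_cont cell_cont)
    show "(E1 \<longlongrightarrow> e0) (at_right 0)"
      unfolding E1_def[abs_def] e0_def using init
      by (intro tendsto_intros) (auto simp: initial_value_def)
    show "D s + (norm_1h m k (p s))\<^sup>2
        + (\<Sum>i\<in>I. \<Sum>j\<in>I. N i (p s) * (LINT s:{0..s}|lborel. N j (p s)) * B i j) = ?\<phi> s" if s: "s \<in> ?J" for s
      using scheme[OF s p_space[OF s]] unfolding D_inner[OF s] memory[OF s] P_def norm_1h_sq .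
  qed (use N_cont N_int norm_eq bound C t in auto)
  also have "\<dots> \<le> ennreal ((l2_norm (lebesgue_on \<Omega>) g)\<^sup>2)
      + ennreal ?C * (\<integral>\<^sup>+s\<in>{0..t}. ennreal ((l2_norm (lebesgue_on \<Omega>) (f s))\<^sup>2) \<partial>lborel)"
    by (intro add_right_mono ennreal_leI e0_le)
  finally show "ennreal ((l2_norm (lebesgue_on \<Omega>) (broken m (cellp (p t))))\<^sup>2
             + (LINT s:{0..t}|lborel. (norm_1h m k (p s))\<^sup>2)
             + (norm_1h m k (hybrid_integral {0..t} p))\<^sup>2)
    \<le> ennreal ((l2_norm (lebesgue_on \<Omega>) g)\<^sup>2)
      + ennreal ?C * (\<integral>\<^sup>+s\<in>{0..t}. ennreal ((l2_norm (lebesgue_on \<Omega>) (f s))\<^sup>2) \<partial>lborel)"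
    unfolding E1_norm[OF t] int_eq[OF t] norm_1h_sq[of _ "hlin _ _ _"] bh_eq P_def .
qed

end
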